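(* Let $(M_1^{m_1},g_1)$ and $(M_2^{m_2},g_2)$ be Einstein manifolds such that $m_2(m_2-1)\,\mathrm{Sc}(g_1)=-m_1(m_1-1)\,\mathrm{Sc}(g_2)\neq0$. Then the product metric $g_1\times g_2$ on $M_1\times M_2$ is conformally almost-Einstein if and only if either $[g_1]$ admits two linearly independent almost-Einstein structures or $[g_2]$ admits two linearly independent almost-Einstein structures.
   Context: Metrics are pseudo-Riemannian; $M_i$ has dimension $m_i$, and $[g]$ denotes the conformal class of $g$. An $m$-manifold $(M,g)$ is Einstein if $\mathrm{Ric}(g)=\frac1m\mathrm{Sc}(g)\,g$ with scalar curvature $\mathrm{Sc}(g)$ constant. The standard tractor bundle $\mathcal T$ of a conformal $n$-manifold $(M,[g])$ is the rank $n+2$ vector bundle carrying the normal conformal tractor connection. Explicitly, for $n\ge3$, a choice of metric $g$ in the class identifies $\mathcal T$ with $\underline{\mathbb R}\oplus T^*M\oplus\underline{\mathbb R}$ (where $\underline{\mathbb R}=M\times\mathbb R$), and the normal tractor connection is $$\nabla_a(\sigma,\mu_b,\tau)=\big(\nabla_a\sigma-\mu_a,\ \nabla_a\mu_b+P_{ab}\sigma+g_{ab}\tau,\ \nabla_a\tau-P_a{}^c\mu_c\big),$$ where on the right $\nabla$ is the Levi-Civita connection of $g$ and $P_{ab}=\frac1{n-2}\big(\mathrm{Ric}_{ab}-\frac{\mathrm{Sc}}{2(n-1)}g_{ab}\big)$. An almost-Einstein structure on $(M,[g])$ is a (nonzero) parallel section of $\mathcal T$, i.e. a parallel standard tractor;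 almost-Einstein structures are linearly independent if these parallel sections are. $(M,[g])$, or $g$, is conformally almost-Einstein if it admits at least one almost-Einstein structure.
   Formalization: Manifolds are taken to be connected (the claim fails for disconnected factors), and for a factor of dimension 2, where the normal tractor connection is not determined by the conformal class, the connection with P = (Sc/4) g is used. *)

theory Defs
  imports "HOL-Analysis.Analysis"
begin

section \<open>Smooth maps between normed spaces\<close>

primrec Ck_on :: "nat \<Rightarrow> 'a::real_normed_vector set \<Rightarrow> ('a \<Rightarrow> 'b::real_normed_vector) \<Rightarrow> bool" where
  "Ck_on 0 S f \<longleftrightarrow> continuous_on S f"
| "Ck_on (Suc k) S f \<longleftrightarrow>
     (\<forall>x\<in>S. f differentiable (at x)) \<and>
     (\<forall>v. Ck_on k S (\<lambda>x. frechet_derivative f (at x) v))"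

text \<open>Only used for open \<open>S\<close>.\<close>
definition smooth_on :: "'a::real_normed_vector set \<Rightarrow> ('a \<Rightarrow> 'b::real_normed_vector) \<Rightarrow> bool" where
  "smooth_on S f \<longleftrightarrow> (\<forall>k. Ck_on k S f)"


section \<open>Smooth manifolds\<close>

text \<open>
  A manifold of dimension \<open>CARD('n)\<close> is given by a topology on its set of points and a smooth
  atlas, indexed by the set \<open>charts\<close>: the chart with index \<open>c\<close> has domain \<open>cdom c\<close> and
  coordinate map \<open>ccrd c\<close>. The coordinate map is only meaningful on its domain, and the atlas
  need not be maximal.
\<close>
record ('p, 'c, 'n) atlas =
  mtop :: "'p topology"
  charts :: "'c set"
  cdom :: "'c \<Rightarrow> 'p set"
  ccrd :: "'c \<Rightarrow> 'p \<Rightarrow> (real, 'n) vec"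

definition cinv :: "('p, 'c, 'n::finite) atlas \<Rightarrow> 'c \<Rightarrow> real ^ 'n \<Rightarrow> 'p" where
  "cinv M c = inv_into (cdom M c) (ccrd M c)"

text \<open>Manifolds are nonempty, connected, Hausdorff and second countable.\<close>
definition smooth_manifold :: "('p, 'c, 'n::finite) atlas \<Rightarrow> bool" where
  "smooth_manifold M \<longleftrightarrow>
     topspace (mtop M) \<noteq> {} \<and> connected_space (mtop M) \<and>
     Hausdorff_space (mtop M) \<and> second_countable (mtop M) \<and>
     (\<Union>c\<in>charts M. cdom M c) = topspace (mtop M) \<and>
     (\<forall>c\<in>charts M. openin (mtop M) (cdom M c) \<and> open (ccrd M c ` cdom M c) \<and>
        homeomorphic_map (subtopology (mtop M) (cdom M c))
          (top_of_set (ccrd M c ` cdom M c)) (ccrd M c)) \<and>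
     (\<forall>c\<in>charts M. \<forall>d\<in>charts M.
        smooth_on (ccrd M c ` (cdom M c \<inter> cdom M d)) (\<lambda>x. ccrd M d (cinv M c x)))"

definition smooth_in_chart ::
  "('p, 'c, 'n::finite) atlas \<Rightarrow> 'c \<Rightarrow> ('p \<Rightarrow> 'v::real_normed_vector) \<Rightarrow> bool" where
  "smooth_in_chart M c f \<longleftrightarrow> smooth_on (ccrd M c ` cdom M c) (\<lambda>x. f (cinv M c x))"

text \<open>\<open>pd M c i f p\<close> is the coordinate derivative \<open>\<partial>f/\<partial>x\<^sup>i\<close> at \<open>p\<close> in the chart \<open>c\<close>.\<close>
definition pd ::
  "('p, 'c, 'n::finite) atlas \<Rightarrow> 'c \<Rightarrow> 'n \<Rightarrow> ('p \<Rightarrow> real) \<Rightarrow> 'p \<Rightarrow> real" where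
  "pd M c i f p = frechet_derivative (\<lambda>x. f (cinv M c x)) (at (ccrd M c p)) (axis i 1)"

text \<open>The Jacobian matrix of the coordinates of \<open>d\<close> with respect to those of \<open>c\<close>, at \<open>p\<close>.\<close>
definition jacobian_mat ::
  "('p, 'c, 'n::finite) atlas \<Rightarrow> 'c \<Rightarrow> 'c \<Rightarrow> 'p \<Rightarrow> real ^ 'n ^ 'n" where
  "jacobian_mat M c d p = (\<chi> i j. pd M c j (\<lambda>q. ccrd M d q $ i) p)"


section \<open>Pseudo-Riemannian metrics and curvature\<close>

text \<open>
  A tensor field is given by its components in every chart, as functions on the chart domain,
  subject to the transformation law on overlaps. A value outside the chart domain is irrelevant.
\<close>
type_synonym ('p, 'c, 'n) metric = "'c \<Rightarrow> 'p \<Rightarrow> ((real, 'n) vec, 'n) vec"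

definition pseudo_riemannian ::
  "('p, 'c, 'n::finite) atlas \<Rightarrow> ('p, 'c, 'n) metric \<Rightarrow> bool" where
  "pseudo_riemannian M g \<longleftrightarrow>
     smooth_manifold M \<and>
     (\<forall>c\<in>charts M. smooth_in_chart M c (g c)) \<and>
     (\<forall>c\<in>charts M. \<forall>p\<in>cdom M c. transpose (g c p) = g c p \<and> det (g c p) \<noteq> 0) \<and>
     (\<forall>c\<in>charts M. \<forall>d\<in>charts M. \<forall>p\<in>cdom M c \<inter> cdom M d.
        g c p = transpose (jacobian_mat M c d p) ** g d p ** jacobian_mat M c d p)"

text \<open>\<open>christoffel M g c k i j\<close> is \<open>\<Gamma>\<^sup>k\<^sub>i\<^sub>j\<close>, so that \<open>\<nabla>\<^sub>i \<partial>\<^sub>j = \<Gamma>\<^sup>k\<^sub>i\<^sub>j \<partial>\<^sub>k\<close>.\<close>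
definition christoffel ::
  "('p, 'c, 'n::finite) atlas \<Rightarrow> ('p, 'c, 'n) metric \<Rightarrow> 'c \<Rightarrow> 'n \<Rightarrow> 'n \<Rightarrow> 'n \<Rightarrow> 'p \<Rightarrow> real" where
  "christoffel M g c k i j p =
     (\<Sum>l\<in>UNIV. matrix_inv (g c p) $ k $ l *
        (pd M c i (\<lambda>q. g c q $ j $ l) p + pd M c j (\<lambda>q. g c q $ i $ l) p
         - pd M c l (\<lambda>q. g c q $ i $ j) p)) / 2"

text \<open>
  \<open>riemann M g c k l i j\<close> is \<open>R\<^sup>k\<^sub>l\<^sub>i\<^sub>j\<close>, where
  \<open>\<nabla>\<^sub>i \<nabla>\<^sub>j \<partial>\<^sub>l - \<nabla>\<^sub>j \<nabla>\<^sub>i \<partial>\<^sub>l = R\<^sup>k\<^sub>l\<^sub>i\<^sub>j \<partial>\<^sub>k\<close>; with the contraction below, round spheres have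
  positive Ricci curvature.
\<close>
definition riemann ::
  "('p, 'c, 'n::finite) atlas \<Rightarrow> ('p, 'c, 'n) metric \<Rightarrow> 'c \<Rightarrow> 'n \<Rightarrow> 'n \<Rightarrow> 'n \<Rightarrow> 'n \<Rightarrow> 'p \<Rightarrow> real" where
  "riemann M g c k l i j p =
     pd M c i (christoffel M g c k j l) p - pd M c j (christoffel M g c k i l) p
     + (\<Sum>r\<in>UNIV. christoffel M g c k i r p * christoffel M g c r j l p
                 - christoffel M g c k j r p * christoffel M g c r i l p)"

definition ricci ::
  "('p, 'c, 'n::finite) atlas \<Rightarrow> ('p, 'c, 'n) metric \<Rightarrow> 'c \<Rightarrow> 'n \<Rightarrow> 'n \<Rightarrow> 'p \<Rightarrow> real" where
  "ricci M g c a b p = (\<Sum>k\<in>UNIV. riemann M g c k a k b p)"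

definition scalar_curvature ::
  "('p, 'c, 'n::finite) atlas \<Rightarrow> ('p, 'c, 'n) metric \<Rightarrow> 'c \<Rightarrow> 'p \<Rightarrow> real" where
  "scalar_curvature M g c p =
     (\<Sum>a\<in>UNIV. \<Sum>b\<in>UNIV. matrix_inv (g c p) $ a $ b * ricci M g c a b p)"

text \<open>\<open>einstein_manifold M g s\<close>: \<open>(M, g)\<close> is Einstein, with constant scalar curvature \<open>s\<close>.\<close>
definition einstein_manifold ::
  "('p, 'c, 'n::finite) atlas \<Rightarrow> ('p, 'c, 'n) metric \<Rightarrow> real \<Rightarrow> bool" where
  "einstein_manifold M g s \<longleftrightarrow>
     pseudo_riemannian M g \<and>
     (\<forall>c\<in>charts M. \<forall>p\<in>cdom M c.
        scalar_curvature M g c p = s \<and>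
        (\<forall>a b. ricci M g c a b p = 1 / real CARD('n) * scalar_curvature M g c p * g c p $ a $ b))"


section \<open>Standard tractors and almost-Einstein structures\<close>

text \<open>
  In dimension \<open>2\<close> the usual formula for the Schouten tensor is undefined and the conformal class
  alone does not determine a normal tractor connection. There we use \<open>P = Sc g / 4\<close>, i.e. the
  tractor connection of the Moebius structure determined by \<open>g\<close>. On an Einstein manifold of any
  dimension \<open>n \<ge> 2\<close> we thus have \<open>P = Sc g / (2 n (n - 1))\<close>.
\<close>
definition schouten ::
  "('p, 'c, 'n::finite) atlas \<Rightarrow> ('p, 'c, 'n) metric \<Rightarrow> 'c \<Rightarrow> 'n \<Rightarrow> 'n \<Rightarrow> 'p \<Rightarrow> real" where
  "schouten M g c a b p =
     (if CARD('n) = 2 then scalar_curvature M g c p / 4 * g c p $ a $ b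
      else 1 / (real CARD('n) - 2) *
        (ricci M g c a b p
         - scalar_curvature M g c p / (2 * (real CARD('n) - 1)) * g c p $ a $ b))"

text \<open>
  A section \<open>(\<sigma>, \<mu>, \<tau>)\<close> of the standard tractor bundle, in the splitting
  \<open>\<real> \<oplus> T\<^sup>*M \<oplus> \<real>\<close> given by a metric of the conformal class: the components of the covector
  field \<open>\<mu>\<close> depend on the chart, the scalars \<open>\<sigma>\<close> and \<open>\<tau>\<close> do not.
\<close>
type_synonym ('p, 'c, 'n) tractor = "'c \<Rightarrow> 'p \<Rightarrow> real \<times> (real, 'n) vec \<times> real"

abbreviation tr_sigma :: "('p, 'c, 'n::finite) tractor \<Rightarrow> 'c \<Rightarrow> 'p \<Rightarrow> real" where
  "tr_sigma T c p \<equiv> fst (T c p)"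
abbreviation tr_mu :: "('p, 'c, 'n::finite) tractor \<Rightarrow> 'c \<Rightarrow> 'p \<Rightarrow> real ^ 'n" where
  "tr_mu T c p \<equiv> fst (snd (T c p))"
abbreviation tr_tau :: "('p, 'c, 'n::finite) tractor \<Rightarrow> 'c \<Rightarrow> 'p \<Rightarrow> real" where
  "tr_tau T c p \<equiv> snd (snd (T c p))"

definition tractor_section ::
  "('p, 'c, 'n::finite) atlas \<Rightarrow> ('p, 'c, 'n) tractor \<Rightarrow> bool" where
  "tractor_section M T \<longleftrightarrow>
     (\<forall>c\<in>charts M. smooth_in_chart M c (T c)) \<and>
     (\<forall>c\<in>charts M. \<forall>d\<in>charts M. \<forall>p\<in>cdom M c \<inter> cdom M d.
        tr_sigma T c p = tr_sigma T d p \<and>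
        tr_mu T c p = transpose (jacobian_mat M c d p) *v tr_mu T d p \<and>
        tr_tau T c p = tr_tau T d p)"

text \<open>The Levi-Civita derivative \<open>\<nabla>\<^sub>a \<mu>\<^sub>b\<close> of a covector field.\<close>
definition covector_deriv ::
  "('p, 'c, 'n::finite) atlas \<Rightarrow> ('p, 'c, 'n) metric \<Rightarrow> ('c \<Rightarrow> 'p \<Rightarrow> real ^ 'n) \<Rightarrow>
    'c \<Rightarrow> 'n \<Rightarrow> 'n \<Rightarrow> 'p \<Rightarrow> real" where
  "covector_deriv M g \<mu> c a b p =
     pd M c a (\<lambda>q. \<mu> c q $ b) p - (\<Sum>k\<in>UNIV. christoffel M g c k a b p * \<mu> c p $ k)"

definition tractor_deriv ::
  "('p, 'c, 'n::finite) atlas \<Rightarrow> ('p, 'c, 'n) metric \<Rightarrow> ('p, 'c, 'n) tractor \<Rightarrow>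
    'c \<Rightarrow> 'n \<Rightarrow> 'p \<Rightarrow> real \<times> (real ^ 'n) \<times> real" where
  "tractor_deriv M g T c a p =
     (pd M c a (tr_sigma T c) p - tr_mu T c p $ a,
      (\<chi> b. covector_deriv M g (tr_mu T) c a b p + schouten M g c a b p * tr_sigma T c p
             + g c p $ a $ b * tr_tau T c p),
      pd M c a (tr_tau T c) p
        - (\<Sum>e\<in>UNIV. \<Sum>d\<in>UNIV.
             schouten M g c a d p * matrix_inv (g c p) $ d $ e * tr_mu T c p $ e))"

definition parallel_tractor ::
  "('p, 'c, 'n::finite) atlas \<Rightarrow> ('p, 'c, 'n) metric \<Rightarrow> ('p, 'c, 'n) tractor \<Rightarrow> bool" where
  "parallel_tractor M g T \<longleftrightarrow>
     tractor_section M T \<and>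
     (\<forall>c\<in>charts M. \<forall>p\<in>cdom M c. \<forall>a. tractor_deriv M g T c a p = 0)"

text \<open>
  The standard tractor bundle of \<open>[g]\<close> and its connection are written in the splitting given by
  the representative \<open>g\<close>; in dimension at least \<open>3\<close> another representative of \<open>[g]\<close> yields an
  isomorphic bundle with connection.
\<close>
definition almost_einstein_structure ::
  "('p, 'c, 'n::finite) atlas \<Rightarrow> ('p, 'c, 'n) metric \<Rightarrow> ('p, 'c, 'n) tractor \<Rightarrow> bool" where
  "almost_einstein_structure M g T \<longleftrightarrow>
     parallel_tractor M g T \<and> (\<exists>c\<in>charts M. \<exists>p\<in>cdom M c. T c p \<noteq> 0)"

definition lin_indep_tractors ::
  "('p, 'c, 'n::finite) atlas \<Rightarrow> ('p, 'c, 'n) tractor \<Rightarrow> ('p, 'c, 'n) tractor \<Rightarrow> bool" where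
  "lin_indep_tractors M S T \<longleftrightarrow>
     (\<forall>\<alpha> \<beta> :: real.
        (\<forall>c\<in>charts M. \<forall>p\<in>cdom M c. \<alpha> *\<^sub>R S c p + \<beta> *\<^sub>R T c p = 0) \<longrightarrow> \<alpha> = 0 \<and> \<beta> = 0)"

definition conformally_almost_einstein ::
  "('p, 'c, 'n::finite) atlas \<Rightarrow> ('p, 'c, 'n) metric \<Rightarrow> bool" where
  "conformally_almost_einstein M g \<longleftrightarrow> (\<exists>T. almost_einstein_structure M g T)"

definition two_independent_almost_einstein ::
  "('p, 'c, 'n::finite) atlas \<Rightarrow> ('p, 'c, 'n) metric \<Rightarrow> bool" where
  "two_independent_almost_einstein M g \<longleftrightarrow>
     (\<exists>S T. almost_einstein_structure M g S \<and> almost_einstein_structure M g T \<and>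
            lin_indep_tractors M S T)"


section \<open>Products\<close>

definition product_manifold ::
  "('p, 'c, 'n::finite) atlas \<Rightarrow> ('q, 'd, 'k::finite) atlas \<Rightarrow> ('p \<times> 'q, 'c \<times> 'd, 'n + 'k) atlas" where
  "product_manifold M N =
     \<lparr> mtop = prod_topology (mtop M) (mtop N),
       charts = charts M \<times> charts N,
       cdom = (\<lambda>(c, d). cdom M c \<times> cdom N d),
       ccrd = (\<lambda>(c, d) (p, q). \<chi> i. case i of Inl a \<Rightarrow> ccrd M c p $ a | Inr b \<Rightarrow> ccrd N d q $ b) \<rparr>"

definition product_metric ::
  "('p, 'c, 'n::finite) metric \<Rightarrow> ('q, 'd, 'k::finite) metric \<Rightarrow> ('p \<times> 'q, 'c \<times> 'd, 'n + 'k) metric" where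
  "product_metric g h = (\<lambda>(c, d) (p, q). \<chi> i j.
     (case (i, j) of
        (Inl a, Inl b) \<Rightarrow> g c p $ a $ b
      | (Inr a, Inr b) \<Rightarrow> h d q $ a $ b
      | _ \<Rightarrow> 0))"

end

(*
  On an Einstein manifold P = l g, so every such manifold carries the parallel tractor (1, 0, -l),
  and tau - l sigma is constant for every parallel tractor (sigma, mu, tau). The hypothesis on the
  scalar curvatures says that the constants l1, l2 of the factors satisfy l1 + l2 = 0, which makes
  the Schouten tensor of the product equal to P1 + P2.

  For a parallel tractor (sigma, mu, tau) on the product, restricting
  ((sigma + tau/l1)/2, mu, (l1 sigma + tau)/2) to a slice M1 x {q} gives a parallel tractor of M1,
  which is independent of (1, 0, -l1) unless it vanishes; likewise for M2. If all these restrictions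
  vanished, so would the original tractor. Conversely, two independent parallel tractors on M1 have
  a nonzero combination with tau = l1 sigma, and such a tractor pulls back to a parallel one on the
  product.
*)
theory Submission
  imports Defs
begin

text \<open>Behind the formulas stands the tractor metric \<open>2 sigma tau + |mu|^2\<close>, which
  the connection preserves. When \<open>P = l g\<close>, the pairing of
  \<open>(sigma, mu, tau)\<close> with \<open>(1, 0, -l)\<close> is \<open>tau - l sigma\<close>,
  whence its constancy, and \<open>tau = l sigma\<close> cuts out the orthogonal complement of that
  tractor, a parallel subbundle of rank \<open>n + 1\<close>. As \<open>(1, 0, -l)\<close> has
  square norm \<open>-2 l\<close>, nonzero, there is an orthogonal projection to the complement;
  this is the map applied on the slices. It does not change \<open>l sigma + tau\<close>, the
  coefficient of the metric in the equation for \<open>mu\<close>. The condition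
  \<open>l1 + l2 = 0\<close> then splits the tractor space of the product, of rank
  \<open>m1 + m2 + 2\<close>, into the two complements of ranks \<open>m1 + 1\<close> and
  \<open>m2 + 1\<close>. The obstacle in coordinates: \<open>frechet_derivative\<close> has no
  meaning where a function is not differentiable, and inverse charts are arbitrary off the chart
  image. So the chain rule always needs a differentiability proof, for the curvature even one for
  the inverse metric.\<close>

section \<open>Calculus\<close>

text \<open>\<open>frechet_derivative\<close> is a choice from the set of all derivatives at a
  point; that set depends only on the germ of the function, so differentiability does not have to be
  assumed.\<close>

lemma frechet_derivative_cong_open:
  assumes "open S" "x \<in> S" "\<And>y. y \<in> S \<Longrightarrow> f y = g y"
  shows "frechet_derivative f (at x) = frechet_derivative g (at x)"
proof -
  have "(f has_derivative D) (at x) \<longleftrightarrow> (g has_derivative D) (at x)" for D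
    using has_derivative_transform_within_open[of f D x UNIV S g]
      has_derivative_transform_within_open[of g D x UNIV S f] assms by auto
  then show ?thesis by (simp add: frechet_derivative_def)
qed

lemma differentiable_cong_open:
  assumes "f differentiable (at x)" "open S" "x \<in> S" "\<And>y. y \<in> S \<Longrightarrow> f y = g y"
  shows "g differentiable (at x)"
  using has_derivative_transform_within_open[of f _ x UNIV S g] assms
  unfolding differentiable_def by blast

lemma has_derivative_affine_comp:
  assumes "bounded_linear L" "bounded_linear A" "f differentiable (at (A x + b))"
  shows "((\<lambda>x. L (f (A x + b))) has_derivative
           (\<lambda>v. L (frechet_derivative f (at (A x + b)) (A v)))) (at x)"
proof -
  have f: "(f has_derivative frechet_derivative f (at (A x + b))) (at (A x + b))"
    using assms(3) by (rule iffD1[OF frechet_derivative_works])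
  have "((\<lambda>x. A x + b) has_derivative A) (at x)"
    using bounded_linear.has_derivative[OF assms(2) has_derivative_ident]
    by (auto intro!: derivative_eq_intros)
  from has_derivative_compose[OF this f] show ?thesis
    by (rule bounded_linear.has_derivative[OF assms(1)])
qed

section \<open>Stability properties of smooth maps\<close>

lemma Ck_on_cong:
  assumes "open S" "\<And>x. x \<in> S \<Longrightarrow> f x = g x" "Ck_on k S f"
  shows "Ck_on k S g"
  using assms(2,3)
proof (induction k arbitrary: f g)
  case 0
  then show ?case by (simp cong: continuous_on_cong)
next
  case (Suc k)
  have "g differentiable (at x)" if "x \<in> S" for x
    using Suc.prems that assms(1) differentiable_cong_open[of f x S g] by auto
  moreover have "Ck_on k S (\<lambda>x. frechet_derivative g (at x) v)" for v
  proof (rule Suc.IH)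
    show "Ck_on k S (\<lambda>x. frechet_derivative f (at x) v)" using Suc.prems by simp
    show "frechet_derivative f (at x) v = frechet_derivative g (at x) v" if "x \<in> S" for x
      using frechet_derivative_cong_open[of S x f g] assms(1) that Suc.prems(1) by simp
  qed
  ultimately show ?case by simp
qed

text \<open>The derivative in direction \<open>v\<close> has again the shape
  \<open>L (f' (A x + b))\<close>, with \<open>f'\<close> the derivative of \<open>f\<close> in
  direction \<open>A v\<close>, so the induction closes without products of derivatives. Projections
  of product coordinates and embeddings of slices are affine, which makes this case of the chain
  rule sufficient.\<close>

lemma Ck_on_affine_comp:
  assumes "bounded_linear L" "bounded_linear A" "open S" "\<And>x. x \<in> S \<Longrightarrow> A x + b \<in> S'" "Ck_on k S' f"
  shows "Ck_on k S (\<lambda>x. L (f (A x + b)))"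
  using assms(5)
proof (induction k arbitrary: f)
  case 0
  have "continuous_on S (\<lambda>x. A x + b)"
    by (intro continuous_intros linear_continuous_on assms)
  from continuous_on_compose2[OF _ this, of S' f] have "continuous_on S (\<lambda>x. f (A x + b))"
    using 0 assms(4) by auto
  then show ?case
    by (auto intro: bounded_linear.continuous_on[OF assms(1)])
next
  case (Suc k)
  have D: "((\<lambda>x. L (f (A x + b))) has_derivative
           (\<lambda>v. L (frechet_derivative f (at (A x + b)) (A v)))) (at x)" if "x \<in> S" for x
    using Suc.prems assms(4)[OF that] by (intro has_derivative_affine_comp assms) auto
  have "Ck_on k S (\<lambda>x. frechet_derivative (\<lambda>x. L (f (A x + b))) (at x) v)" for v
  proof (rule Ck_on_cong[OF assms(3)])
    show "Ck_on k S (\<lambda>x. L (frechet_derivative f (at (A x + b)) (A v)))"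
      using Suc.prems by (intro Suc.IH[of "\<lambda>y. frechet_derivative f (at y) (A v)"]) auto
    show "L (frechet_derivative f (at (A x + b)) (A v)) =
        frechet_derivative (\<lambda>x. L (f (A x + b))) (at x) v" if "x \<in> S" for x
      using frechet_derivative_at[OF D[OF that]] by metis
  qed
  then show ?case using D by (auto simp: differentiable_def)
qed

lemma Ck_on_const: "Ck_on k S (\<lambda>x. a)"
  by (induction k arbitrary: a) auto

lemma Ck_on_add:
  assumes "open S" "Ck_on k S f" "Ck_on k S g"
  shows "Ck_on k S (\<lambda>x. f x + g x)"
  using assms(2,3)
proof (induction k arbitrary: f g)
  case 0
  then show ?case by (auto intro: continuous_on_add)
next
  case (Suc k)
  have "Ck_on k S (\<lambda>x. frechet_derivative (\<lambda>x. f x + g x) (at x) v)" for v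
  proof (rule Ck_on_cong[OF assms(1)])
    show "Ck_on k S (\<lambda>x. frechet_derivative f (at x) v + frechet_derivative g (at x) v)"
      using Suc.prems by (intro Suc.IH) auto
    show "frechet_derivative f (at x) v + frechet_derivative g (at x) v =
       frechet_derivative (\<lambda>x. f x + g x) (at x) v" if "x \<in> S" for x
      proof -
      have "(f has_derivative frechet_derivative f (at x)) (at x)"
        "(g has_derivative frechet_derivative g (at x)) (at x)"
        using Suc.prems that by (simp_all flip: frechet_derivative_works)
      from frechet_derivative_at[OF has_derivative_add[OF this]] show ?thesis by metis
    qed
  qed
  then show ?case using Suc.prems by auto
qed

lemma smooth_on_affine_comp:
  assumes "bounded_linear L" "bounded_linear A" "open S" "\<And>x. x \<in> S \<Longrightarrow> A x + b \<in> S'" "smooth_on S' f"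
  shows "smooth_on S (\<lambda>x. L (f (A x + b)))"
  using assms(5) Ck_on_affine_comp[OF assms(1-4)] by (simp add: smooth_on_def)

lemma smooth_on_const: "smooth_on S (\<lambda>x. a)"
  by (simp add: smooth_on_def Ck_on_const)

lemma smooth_on_add: "open S \<Longrightarrow> smooth_on S f \<Longrightarrow> smooth_on S g \<Longrightarrow> smooth_on S (\<lambda>x. f x + g x)"
  by (simp add: smooth_on_def Ck_on_add)

lemma smooth_on_cong:
  "open S \<Longrightarrow> (\<And>x. x \<in> S \<Longrightarrow> f x = g x) \<Longrightarrow> smooth_on S f \<Longrightarrow> smooth_on S g"
  using Ck_on_cong[of S f g] by (auto simp: smooth_on_def)

lemma smooth_on_differentiable: "smooth_on S f \<Longrightarrow> x \<in> S \<Longrightarrow> f differentiable (at x)"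
  unfolding smooth_on_def by (metis Ck_on.simps(2))

lemma smooth_on_frechet_derivative:
  "smooth_on S f \<Longrightarrow> smooth_on S (\<lambda>x. frechet_derivative f (at x) v)"
  unfolding smooth_on_def by (metis Ck_on.simps(2))

lemma smooth_on_linear_comp:
  assumes "bounded_linear L" "open S" "smooth_on S f"
  shows "smooth_on S (\<lambda>x. L (f x))"
  using smooth_on_affine_comp[OF assms(1) bounded_linear_ident assms(2), of 0 S f] assms(3) by simp

section \<open>Differentiability of the inverse matrix\<close>

lemma differentiable_prod:
  fixes f :: "'i \<Rightarrow> 'a::real_normed_vector \<Rightarrow> 'b::real_normed_field"
  assumes "\<And>i. i \<in> I \<Longrightarrow> f i differentiable (at x)"
  shows "(\<lambda>x. \<Prod>i\<in>I. f i x) differentiable (at x)"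
proof -
  have "\<forall>i\<in>I. \<exists>D. (f i has_derivative D) (at x)" using assms by (auto simp: differentiable_def)
  then obtain D where "\<And>i. i \<in> I \<Longrightarrow> (f i has_derivative D i) (at x)" by metis
  from has_derivative_prod[of I f D, OF this] show ?thesis by (auto simp: differentiable_def)
qed

lemma differentiable_det:
  fixes A :: "'a::real_normed_vector \<Rightarrow> real ^ 'n ^ 'n"
  assumes "\<And>i j. (\<lambda>x. A x $ i $ j) differentiable (at x)"
  shows "(\<lambda>x. det (A x)) differentiable (at x)"
  unfolding det_def
proof (rule differentiable_sum)
  show "\<forall>p\<in>{p. p permutes UNIV}.
      (\<lambda>x. of_int (sign p) * (\<Prod>i\<in>UNIV. A x $ i $ p i)) differentiable (at x)"
    by (intro ballI differentiable_mult differentiable_const differentiable_prod assms)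
qed (simp add: finite_permutations)

lemma matrix_inv_mult:
  fixes A :: "'a::semiring_1 ^ 'n ^ 'm"
  assumes "invertible A"
  shows "A ** matrix_inv A = mat 1" "matrix_inv A ** A = mat 1"
  using someI_ex[OF assms[unfolded invertible_def]] unfolding matrix_inv_def by blast+

text \<open>Column \<open>l\<close> of the inverse solves \<open>A x = axis l 1\<close>, so Cramer's
  rule applies. It exhibits the entries as quotients of determinants, whose differentiability is
  clear.\<close>

lemma matrix_inv_component:
  fixes A :: "real ^ 'n ^ 'n"
  assumes "det A \<noteq> 0"
  shows "matrix_inv A $ k $ l = det (\<chi> i j. if j = k then axis l 1 $ i else A $ i $ j) / det A"
proof -
  have "invertible A" using assms by (simp add: invertible_det_nz)
  then have "A *v (matrix_inv A *v axis l 1) = axis l 1"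
    by (simp add: matrix_vector_mul_assoc matrix_inv_mult)
  then have "matrix_inv A *v axis l 1 =
      (\<chi> k. det (\<chi> i j. if j = k then axis l 1 $ i else A $ i $ j) / det A)"
    using cramer[OF assms, of "matrix_inv A *v axis l 1" "axis l 1"] by simp
  then show ?thesis
    unfolding matrix_vector_mult_basis column_def vec_eq_iff vec_lambda_beta by blast
qed

lemma differentiable_matrix_inv:
  fixes A :: "'a::real_normed_vector \<Rightarrow> real ^ 'n ^ 'n"
  assumes "\<And>i j. (\<lambda>x. A x $ i $ j) differentiable (at x)" "open S" "x \<in> S"
    "\<And>y. y \<in> S \<Longrightarrow> det (A y) \<noteq> 0"
  shows "(\<lambda>x. matrix_inv (A x) $ k $ l) differentiable (at x)"
\<comment> \<open>The determinant is nonzero only on \<open>S\<close>, so the quotient formula is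
  available near \<open>x\<close> but not globally.\<close>
proof (rule differentiable_cong_open[OF _ assms(2,3)])
  show "(\<lambda>x. det (\<chi> i j. if j = k then axis l 1 $ i else A x $ i $ j) / det (A x)) differentiable (at x)"
  proof (intro differentiable_divide differentiable_det)
    show "(\<lambda>x. (\<chi> i j. if j = k then axis l 1 $ i else A x $ i $ j) $ i' $ j') differentiable (at x)"
      for i' j'
      using assms(1) by (cases "j' = k") (auto)
  qed (use assms in auto)
qed (simp add: matrix_inv_component assms(4))

section \<open>Charts\<close>

definition diff_in_chart ::
  "('p, 'c, 'n::finite) atlas \<Rightarrow> 'c \<Rightarrow> ('p \<Rightarrow> 'v::real_normed_vector) \<Rightarrow> 'p \<Rightarrow> bool" where
  "diff_in_chart M c f p \<longleftrightarrow> (\<lambda>x. f (cinv M c x)) differentiable (at (ccrd M c p))"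

context
  fixes M :: "('p, 'c, 'n::finite) atlas" and c
  assumes M: "smooth_manifold M" and c: "c \<in> charts M"
begin

lemma open_chart_image: "open (ccrd M c ` cdom M c)"
  using M c by (auto simp: smooth_manifold_def)

lemma openin_cdom: "openin (mtop M) (cdom M c)"
  using M c by (auto simp: smooth_manifold_def)

lemma chart_homeomorphic:
  "homeomorphic_map (subtopology (mtop M) (cdom M c)) (top_of_set (ccrd M c ` cdom M c)) (ccrd M c)"
  using M c by (auto simp: smooth_manifold_def)

lemma inj_on_ccrd: "inj_on (ccrd M c) (cdom M c)"
  using homeomorphic_imp_injective_map[OF chart_homeomorphic] openin_subset[OF openin_cdom]
  by (simp add: Int_absorb1)

lemma cinv_ccrd: "p \<in> cdom M c \<Longrightarrow> cinv M c (ccrd M c p) = p"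
  by (simp add: cinv_def inj_on_ccrd)

lemma smooth_in_chart_diff:
  "smooth_in_chart M c f \<Longrightarrow> p \<in> cdom M c \<Longrightarrow> diff_in_chart M c f p"
  by (simp add: smooth_in_chart_def diff_in_chart_def smooth_on_differentiable)

lemma smooth_in_chart_linear:
  "bounded_linear L \<Longrightarrow> smooth_in_chart M c f \<Longrightarrow> smooth_in_chart M c (\<lambda>p. L (f p))"
  unfolding smooth_in_chart_def by (rule smooth_on_linear_comp[OF _ open_chart_image])

lemma smooth_in_chart_pd:
  assumes "smooth_in_chart M c f"
  shows "smooth_in_chart M c (pd M c i f)"
  unfolding smooth_in_chart_def
proof (rule smooth_on_cong[OF open_chart_image])
  show "smooth_on (ccrd M c ` cdom M c)
      (\<lambda>x. frechet_derivative (\<lambda>x. f (cinv M c x)) (at x) (axis i 1))"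
    using assms by (simp add: smooth_in_chart_def smooth_on_frechet_derivative)
qed (auto simp: pd_def cinv_ccrd)

end

section \<open>Differentiability of the metric and of its Christoffel symbols\<close>

lemma smooth_metric_component:
  fixes M :: "('p, 'c, 'n::finite) atlas"
  assumes "pseudo_riemannian M g" "c \<in> charts M"
  shows "smooth_in_chart M c (\<lambda>p. g c p $ i $ j)"
proof -
  have "bounded_linear (\<lambda>A :: real ^ 'n ^ 'n. A $ i $ j)"
    using bounded_linear_compose[OF bounded_linear_vec_nth[of j] bounded_linear_vec_nth[of i]] .
  moreover have "smooth_manifold M" "smooth_in_chart M c (g c)"
    using assms unfolding pseudo_riemannian_def by blast+
  ultimately show ?thesis
    using smooth_in_chart_linear[of M c "\<lambda>A. A $ i $ j" "g c"] assms(2) by simp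
qed

lemma metric_det_nonzero:
  "pseudo_riemannian M g \<Longrightarrow> c \<in> charts M \<Longrightarrow> p \<in> cdom M c \<Longrightarrow> det (g c p) \<noteq> 0"
  unfolding pseudo_riemannian_def by blast

text \<open>The Ricci tensor differentiates the Christoffel symbols once, so one derivative of the
  inverse metric is enough; the derivatives of the metric itself are smooth.\<close>

lemma diff_christoffel:
  assumes g: "pseudo_riemannian M g" and c: "c \<in> charts M" and p: "p \<in> cdom M c"
  shows "diff_in_chart M c (christoffel M g c k i j) p"
proof -
  have M: "smooth_manifold M" using g by (simp add: pseudo_riemannian_def)
  have "diff_in_chart M c (pd M c i (\<lambda>q. g c q $ j $ l)) p" for i j l
    by (intro smooth_in_chart_diff[OF M c] smooth_in_chart_pd[OF M c] smooth_metric_component g c p)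
  moreover have "diff_in_chart M c (\<lambda>q. matrix_inv (g c q) $ k $ l) p" for k l
    unfolding diff_in_chart_def
  proof (rule differentiable_matrix_inv[OF _ open_chart_image[OF M c]])
    show "(\<lambda>x. g c (cinv M c x) $ i $ j) differentiable (at (ccrd M c p))" for i j
      using smooth_in_chart_diff[OF M c smooth_metric_component[OF g c] p]
      by (simp add: diff_in_chart_def)
    show "det (g c (cinv M c y)) \<noteq> 0" if "y \<in> ccrd M c ` cdom M c" for y
      using that metric_det_nonzero[OF g c] by (auto simp: cinv_ccrd[OF M c])
  qed (use p in auto)
  ultimately show ?thesis
    unfolding diff_in_chart_def christoffel_def
    by (intro differentiable_divide differentiable_sum differentiable_mult ballI
        differentiable_diff differentiable_add differentiable_const) simp_all
qed

section \<open>Splitting of the coordinate space along a partition of the indices\<close>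

definition restrict_index :: "('n \<Rightarrow> 'm) \<Rightarrow> real ^ 'm \<Rightarrow> real ^ 'n" where
  "restrict_index u y = (\<chi> i. y $ u i)"

text \<open>Used in two roles: on points it parametrizes coordinate slices of the product, on
  covectors it is the pullback along the projection to a factor. Dually,
  \<open>restrict_index\<close> projects points and restricts covectors to a slice.\<close>

definition extend_index :: "('n \<Rightarrow> 'm) \<Rightarrow> real ^ 'n \<Rightarrow> real ^ 'm" where
  "extend_index u x = (\<chi> k. if k \<in> range u then x $ inv u k else 0)"

lemma restrict_index_nth [simp]: "restrict_index u y $ i = y $ u i"
  by (simp add: restrict_index_def)

lemma extend_index_nth: "inj u \<Longrightarrow> extend_index u x $ u i = x $ i"
  by (simp add: extend_index_def)

lemma extend_index_nth_zero: "k \<notin> range u \<Longrightarrow> extend_index u x $ k = 0"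
  by (simp add: extend_index_def)

lemma bounded_linear_restrict_index:
  "bounded_linear (restrict_index (u :: 'n::finite \<Rightarrow> 'm::finite))"
  by (auto intro!: linearI simp: vec_eq_iff simp flip: linear_conv_bounded_linear)

lemma bounded_linear_extend_index:
  "bounded_linear (extend_index (u :: 'n::finite \<Rightarrow> 'm::finite))"
  by (auto intro!: linearI simp: vec_eq_iff extend_index_def simp flip: linear_conv_bounded_linear)

text \<open>\<open>u\<close> and \<open>v\<close> stand for \<open>Inl\<close> and
  \<open>Inr\<close>. The abstract form is symmetric, whereas exchanging the summands of a sum type
  changes the type.\<close>

locale index_split =
  fixes u :: "'n::finite \<Rightarrow> 'm::finite" and v :: "'k::finite \<Rightarrow> 'm"
  assumes inj_u: "inj u" and inj_v: "inj v"
    and disj: "range u \<inter> range v = {}" and cover: "range u \<union> range v = UNIV"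
begin

lemma swap_index: "index_split v u"
  by unfold_locales (use inj_u inj_v disj cover in auto)

lemma sum_split:
  fixes f :: "'m \<Rightarrow> 'a::comm_monoid_add"
  shows "(\<Sum>k\<in>UNIV. f k) = (\<Sum>i\<in>UNIV. f (u i)) + (\<Sum>j\<in>UNIV. f (v j))"
proof -
  have "(\<Sum>k\<in>UNIV. f k) = (\<Sum>k\<in>range u. f k) + (\<Sum>k\<in>range v. f k)"
    using sum.union_disjoint[of "range u" "range v" f] disj cover by simp
  then show ?thesis by (simp add: sum.reindex inj_u inj_v)
qed

lemma card_split: "CARD('m) = CARD('n) + CARD('k)"
  using sum_split[of "\<lambda>_. 1 :: nat"] by simp

lemma u_neq_v: "u i \<noteq> v j" "v j \<noteq> u i"
  using disj by auto

lemma u_eq: "u i = u j \<longleftrightarrow> i = j" and v_eq: "v i' = v j' \<longleftrightarrow> i' = j'"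
  using inj_u inj_v by (auto simp: inj_def)

lemma index_cases: obtains i where "k = u i" | j where "k = v j"
  using cover by (metis UNIV_I Un_iff imageE)

lemma all_index: "(\<forall>k. P k) \<longleftrightarrow> (\<forall>i. P (u i)) \<and> (\<forall>j. P (v j))"
  by (metis index_cases)

lemma extend_index_u [simp]: "extend_index u x $ u i = x $ i" "extend_index u x $ v j = 0"
  using u_neq_v by (auto simp: extend_index_nth[OF inj_u] intro!: extend_index_nth_zero)

lemma extend_index_v [simp]: "extend_index v x $ v i = x $ i" "extend_index v x $ u j = 0"
  using u_neq_v by (auto simp: extend_index_nth[OF inj_v] intro!: extend_index_nth_zero)

lemma restrict_axis:
  "restrict_index u (axis (u i) 1) = axis i 1" "restrict_index u (axis (v j) 1) = 0"
  by (auto simp: vec_eq_iff axis_def u_neq_v u_eq)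

lemma extend_axis: "extend_index u (axis i 1) = axis (u i) 1"
  unfolding vec_eq_iff all_index by (auto simp: axis_def u_neq_v u_eq)

lemma matrix_inv_block:
  fixes A :: "real ^ 'm ^ 'm"
  assumes "\<And>a b. A $ u a $ u b = B $ a $ b" "\<And>a b. A $ v a $ v b = C $ a $ b"
    "\<And>a b. A $ u a $ v b = 0" "\<And>a b. A $ v a $ u b = 0"
    "invertible B" "invertible C"
  shows "matrix_inv A $ u a $ u b = matrix_inv B $ a $ b"
    and "matrix_inv A $ u a $ v b' = 0" and "matrix_inv A $ v b' $ u a = 0"
proof -
  \<comment> \<open>The block diagonal matrix with blocks \<open>matrix_inv B\<close> and
    \<open>matrix_inv C\<close>, given row by row. It is checked to be a two-sided inverse of
    \<open>A\<close>; uniqueness of inverses then identifies it with the chosen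
    \<open>matrix_inv A\<close>.\<close>
  define W :: "real ^ 'm ^ 'm" where
    "W = (\<chi> k. if k \<in> range u then extend_index u (matrix_inv B $ inv u k)
              else extend_index v (matrix_inv C $ inv v k))"
  have W: "W $ u a = extend_index u (matrix_inv B $ a)" "W $ v b = extend_index v (matrix_inv C $ b)"
    for a b using u_neq_v by (auto simp: W_def inj_u inj_v)
  have "(\<Sum>i\<in>UNIV. B $ a $ i * matrix_inv B $ i $ b) = (if a = b then 1 else 0)" for a b
    using arg_cong[OF matrix_inv_mult(1)[OF assms(5)], of "\<lambda>A. A $ a $ b"]
    by (simp add: matrix_matrix_mult_def mat_def)
  moreover have "(\<Sum>i\<in>UNIV. matrix_inv B $ a $ i * B $ i $ b) = (if a = b then 1 else 0)" for a b
    using arg_cong[OF matrix_inv_mult(2)[OF assms(5)], of "\<lambda>A. A $ a $ b"]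
    by (simp add: matrix_matrix_mult_def mat_def)
  moreover have "(\<Sum>i\<in>UNIV. C $ a $ i * matrix_inv C $ i $ b) = (if a = b then 1 else 0)" for a b
    using arg_cong[OF matrix_inv_mult(1)[OF assms(6)], of "\<lambda>A. A $ a $ b"]
    by (simp add: matrix_matrix_mult_def mat_def)
  moreover have "(\<Sum>i\<in>UNIV. matrix_inv C $ a $ i * C $ i $ b) = (if a = b then 1 else 0)" for a b
    using arg_cong[OF matrix_inv_mult(2)[OF assms(6)], of "\<lambda>A. A $ a $ b"]
    by (simp add: matrix_matrix_mult_def mat_def)
  ultimately have AW: "A ** W = mat 1" "W ** A = mat 1"
    by (auto simp: vec_eq_iff all_index matrix_matrix_mult_def mat_def sum_split W assms u_neq_v u_eq v_eq)
  then have "invertible A" by (auto simp: invertible_def)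
  then have "matrix_inv A = W"
    by (metis AW(1) matrix_inv_mult(2) matrix_mul_assoc matrix_mul_lid matrix_mul_rid)
  then show "matrix_inv A $ u a $ u b = matrix_inv B $ a $ b"
    and "matrix_inv A $ u a $ v b' = 0" and "matrix_inv A $ v b' $ u a = 0"
    by (auto simp: W)
qed

end

section \<open>Product charts\<close>

text \<open>
  A product of two manifolds, with coordinates, points and charts of the factors accessed through
  abstract injections and projections. Since the assumptions are symmetric under exchanging the
  factors, everything proved for the first factor holds for the second one.
\<close>
locale product_atlas = index_split u v
  for u :: "'n1::finite \<Rightarrow> 'm::finite" and v :: "'n2::finite \<Rightarrow> 'm" +
  fixes M :: "('p, 'c, 'm) atlas" and M1 :: "('p1, 'c1, 'n1) atlas" and M2 :: "('p2, 'c2, 'n2) atlas"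
    and pr1 :: "'p \<Rightarrow> 'p1" and pr2 :: "'p \<Rightarrow> 'p2" and mk :: "'p1 \<Rightarrow> 'p2 \<Rightarrow> 'p"
    and cp1 :: "'c \<Rightarrow> 'c1" and cp2 :: "'c \<Rightarrow> 'c2" and mkc :: "'c1 \<Rightarrow> 'c2 \<Rightarrow> 'c"
  assumes man1: "smooth_manifold M1" and man2: "smooth_manifold M2"
    and pr_mk: "pr1 (mk p q) = p" "pr2 (mk p q) = q" "mk (pr1 x) (pr2 x) = x"
    and cp_mkc: "cp1 (mkc c d) = c" "cp2 (mkc c d) = d" "mkc (cp1 z) (cp2 z) = z"
    and charts_iff: "z \<in> charts M \<longleftrightarrow> cp1 z \<in> charts M1 \<and> cp2 z \<in> charts M2"
    and cdom_iff: "x \<in> cdom M z \<longleftrightarrow> pr1 x \<in> cdom M1 (cp1 z) \<and> pr2 x \<in> cdom M2 (cp2 z)"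
    and ccrd_nth: "ccrd M z x $ u i = ccrd M1 (cp1 z) (pr1 x) $ i"
      "ccrd M z x $ v j = ccrd M2 (cp2 z) (pr2 x) $ j"
begin

lemma swap_atlas: "product_atlas v u M M2 M1 pr2 pr1 (\<lambda>q p. mk p q) cp2 cp1 (\<lambda>d c. mkc c d)"
  by (intro product_atlas.intro swap_index product_atlas_axioms.intro)
    (auto simp: man1 man2 pr_mk cp_mkc charts_iff cdom_iff ccrd_nth)

context
  fixes z assumes z: "z \<in> charts M"
begin

lemma cp1_charts: "cp1 z \<in> charts M1" and cp2_charts: "cp2 z \<in> charts M2"
  using z by (auto simp: charts_iff)

lemma restrict_ccrd: "restrict_index u (ccrd M z x) = ccrd M1 (cp1 z) (pr1 x)"
  "restrict_index v (ccrd M z x) = ccrd M2 (cp2 z) (pr2 x)"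
  by (auto simp: vec_eq_iff ccrd_nth)

lemma chart_image:
  "ccrd M z ` cdom M z = {y. restrict_index u y \<in> ccrd M1 (cp1 z) ` cdom M1 (cp1 z) \<and>
                           restrict_index v y \<in> ccrd M2 (cp2 z) ` cdom M2 (cp2 z)}" (is "_ = ?R")
proof (intro set_eqI iffI)
  fix y assume "y \<in> ?R"
  then obtain p q where pq: "p \<in> cdom M1 (cp1 z)" "restrict_index u y = ccrd M1 (cp1 z) p"
    "q \<in> cdom M2 (cp2 z)" "restrict_index v y = ccrd M2 (cp2 z) q" by auto
  have "y $ u i = ccrd M1 (cp1 z) p $ i" "y $ v j = ccrd M2 (cp2 z) q $ j" for i j
    by (simp_all flip: pq(2,4))
  then have "y = ccrd M z (mk p q)"
    unfolding vec_eq_iff all_index by (simp add: ccrd_nth pr_mk)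
  then show "y \<in> ccrd M z ` cdom M z" using pq by (auto simp: cdom_iff pr_mk)
qed (auto simp: restrict_ccrd cdom_iff)

lemma open_product_chart: "open (ccrd M z ` cdom M z)"
proof -
  have "continuous_on UNIV (restrict_index w)" for w :: "'i::finite \<Rightarrow> 'm"
    by (rule linear_continuous_on[OF bounded_linear_restrict_index])
  then have "open (restrict_index u -` (ccrd M1 (cp1 z) ` cdom M1 (cp1 z)))"
    "open (restrict_index v -` (ccrd M2 (cp2 z) ` cdom M2 (cp2 z)))"
    using open_chart_image[OF man1 cp1_charts] open_chart_image[OF man2 cp2_charts]
    by (auto intro: open_vimage)
  then have "open (restrict_index u -` (ccrd M1 (cp1 z) ` cdom M1 (cp1 z)) \<inter>
    restrict_index v -` (ccrd M2 (cp2 z) ` cdom M2 (cp2 z)))" by (rule open_Int)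
  then show ?thesis
    by (simp add: chart_image vimage_def Collect_conj_eq)
qed

lemma product_inj: "inj_on (ccrd M z) (cdom M z)"
proof (rule inj_onI)
  fix x y assume xy: "x \<in> cdom M z" "y \<in> cdom M z" "ccrd M z x = ccrd M z y"
  have "pr1 x = pr1 y"
    using xy inj_on_ccrd[OF man1 cp1_charts] restrict_ccrd(1)[of x] restrict_ccrd(1)[of y]
    by (auto simp: cdom_iff dest: inj_onD)
  moreover have "pr2 x = pr2 y"
    using xy inj_on_ccrd[OF man2 cp2_charts] restrict_ccrd(2)[of x] restrict_ccrd(2)[of y]
    by (auto simp: cdom_iff dest: inj_onD)
  ultimately show "x = y" by (metis pr_mk(3))
qed

lemma cinv_product: "x \<in> cdom M z \<Longrightarrow> cinv M z (ccrd M z x) = x"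
  by (simp add: cinv_def product_inj)

lemma pr1_cinv:
  assumes "y \<in> ccrd M z ` cdom M z"
  shows "pr1 (cinv M z y) = cinv M1 (cp1 z) (restrict_index u y)"
  using assms by (auto simp: cinv_product restrict_ccrd cinv_ccrd[OF man1 cp1_charts] cdom_iff)

lemma pd_product_cong:
  assumes "x \<in> cdom M z" "\<And>y. y \<in> cdom M z \<Longrightarrow> f y = f' y"
  shows "pd M z i f x = pd M z i f' x"
proof -
  have "frechet_derivative (\<lambda>x. f (cinv M z x)) (at (ccrd M z x)) =
        frechet_derivative (\<lambda>x. f' (cinv M z x)) (at (ccrd M z x))"
    using assms
    by (intro frechet_derivative_cong_open[OF open_product_chart]) (auto simp: cinv_product)
  then show ?thesis by (simp add: pd_def)
qed

lemma pd_product_zero: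
  assumes "x \<in> cdom M z" "\<And>y. y \<in> cdom M z \<Longrightarrow> f y = 0"
  shows "pd M z i f x = 0"
  using pd_product_cong[of x f "\<lambda>_. 0" i] assms by (simp add: pd_def)

text \<open>In coordinates a pullback is a composition with the linear map
  \<open>restrict_index u\<close>, which sends the axes \<open>u i\<close> to the axes of the factor
  and kills the axes \<open>v j\<close>.\<close>

lemma pd_pullback:
  assumes x: "x \<in> cdom M z" and F: "diff_in_chart M1 (cp1 z) F (pr1 x)"
    and f: "\<And>y. y \<in> cdom M z \<Longrightarrow> f y = F (pr1 y)"
  shows "pd M z (u i) f x = pd M1 (cp1 z) i F (pr1 x)" and "pd M z (v j) f x = 0"
proof -
  let ?F = "\<lambda>x. F (cinv M1 (cp1 z) x)" and ?y = "ccrd M z x"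
  \<comment> \<open>The summand 0 puts the linear map into the affine form of
    \<open>has_derivative_affine_comp\<close>.\<close>
  have d: "?F differentiable (at (restrict_index u ?y + 0))"
    using F by (simp add: diff_in_chart_def restrict_ccrd)
  have "frechet_derivative (\<lambda>y. f (cinv M z y)) (at ?y) =
      frechet_derivative (\<lambda>y. ?F (restrict_index u y + 0)) (at ?y)"
    using x by (intro frechet_derivative_cong_open[OF open_product_chart])
      (auto simp: f cinv_product simp flip: pr1_cinv)
  also have "\<dots> = (\<lambda>v. frechet_derivative ?F (at (restrict_index u ?y)) (restrict_index u v))"
    using frechet_derivative_at[OF has_derivative_affine_comp[OF bounded_linear_ident
      bounded_linear_restrict_index d]] by simp
  finally have *: "pd M z k f x =
      frechet_derivative ?F (at (restrict_index u ?y)) (restrict_index u (axis k 1))" for k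
    by (simp add: pd_def)
  show "pd M z (u i) f x = pd M1 (cp1 z) i F (pr1 x)"
    unfolding * by (simp add: restrict_axis pd_def restrict_ccrd)
  show "pd M z (v j) f x = 0"
    using linear_frechet_derivative[OF d] by (simp add: * restrict_axis linear_0)
qed

lemma smooth_pullback:
  assumes F: "smooth_in_chart M1 (cp1 z) F" and L: "bounded_linear L"
    and f: "\<And>y. y \<in> cdom M z \<Longrightarrow> f y = L (F (pr1 y))"
  shows "smooth_in_chart M z f"
  unfolding smooth_in_chart_def
proof (rule smooth_on_cong[OF open_product_chart])
  show "smooth_on (ccrd M z ` cdom M z) (\<lambda>y. L (F (cinv M1 (cp1 z) (restrict_index u y + 0))))"
    using F unfolding smooth_in_chart_def
    by (intro smooth_on_affine_comp[OF L bounded_linear_restrict_index open_product_chart])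
      (auto simp: restrict_ccrd cdom_iff)
  show "L (F (cinv M1 (cp1 z) (restrict_index u y + 0))) = f (cinv M z y)"
    if "y \<in> ccrd M z ` cdom M z" for y
    using that by (auto simp: f cinv_product simp flip: pr1_cinv)
qed

text \<open>In coordinates the slice through \<open>q\<close> is the affine embedding that fills the
  \<open>v\<close>-entries with the coordinates of \<open>q\<close>. This is what turns restriction
  to a slice into an affine composition.\<close>

lemma cinv_slice:
  assumes "x \<in> ccrd M1 (cp1 z) ` cdom M1 (cp1 z)" and q: "q \<in> cdom M2 (cp2 z)"
  shows "extend_index u x + extend_index v (ccrd M2 (cp2 z) q) \<in> ccrd M z ` cdom M z"
    and "cinv M z (extend_index u x + extend_index v (ccrd M2 (cp2 z) q)) =
      mk (cinv M1 (cp1 z) x) q"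
proof -
  obtain p where p: "p \<in> cdom M1 (cp1 z)" "x = ccrd M1 (cp1 z) p" using assms by auto
  have "extend_index u x + extend_index v (ccrd M2 (cp2 z) q) = ccrd M z (mk p q)"
    unfolding vec_eq_iff all_index by (simp add: ccrd_nth pr_mk p)
  moreover have "mk p q \<in> cdom M z" using p q by (simp add: cdom_iff pr_mk)
  ultimately show "extend_index u x + extend_index v (ccrd M2 (cp2 z) q) \<in> ccrd M z ` cdom M z"
    "cinv M z (extend_index u x + extend_index v (ccrd M2 (cp2 z) q)) = mk (cinv M1 (cp1 z) x) q"
    by (simp_all add: cinv_product p cinv_ccrd[OF man1 cp1_charts])
qed

lemma pd_slice:
  assumes p: "p \<in> cdom M1 (cp1 z)" and q: "q \<in> cdom M2 (cp2 z)"
    and f: "diff_in_chart M z f (mk p q)"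
  shows "pd M1 (cp1 z) i (\<lambda>p. f (mk p q)) p = pd M z (u i) f (mk p q)"
proof -
  let ?f = "\<lambda>y. f (cinv M z y)" and ?x = "ccrd M1 (cp1 z) p"
    and ?b = "extend_index v (ccrd M2 (cp2 z) q)"
  have y: "extend_index u ?x + ?b = ccrd M z (mk p q)"
    unfolding vec_eq_iff all_index by (simp add: ccrd_nth pr_mk)
  have d: "?f differentiable (at (extend_index u ?x + ?b))"
    using f by (simp add: diff_in_chart_def y)
  have "frechet_derivative (\<lambda>x. f (mk (cinv M1 (cp1 z) x) q)) (at ?x) =
      frechet_derivative (\<lambda>x. ?f (extend_index u x + ?b)) (at ?x)"
    using p by (intro frechet_derivative_cong_open[OF open_chart_image[OF man1 cp1_charts]])
      (simp_all add: cinv_slice(2)[OF _ q])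
  also have "\<dots> = (\<lambda>v. frechet_derivative ?f (at (ccrd M z (mk p q))) (extend_index u v))"
    using frechet_derivative_at[OF has_derivative_affine_comp[OF bounded_linear_ident
      bounded_linear_extend_index d]] by (simp add: y)
  finally show ?thesis by (simp add: pd_def extend_axis)
qed

lemma smooth_slice:
  assumes f: "smooth_in_chart M z f" and L: "bounded_linear L" and q: "q \<in> cdom M2 (cp2 z)"
  shows "smooth_in_chart M1 (cp1 z) (\<lambda>p. L (f (mk p q)))"
  unfolding smooth_in_chart_def
proof (rule smooth_on_cong[OF open_chart_image[OF man1 cp1_charts]])
  let ?b = "extend_index v (ccrd M2 (cp2 z) q)"
  show "smooth_on (ccrd M1 (cp1 z) ` cdom M1 (cp1 z)) (\<lambda>x. L (f (cinv M z (extend_index u x + ?b))))"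
    using cinv_slice(1)[OF _ q] f[unfolded smooth_in_chart_def]
    by (rule smooth_on_affine_comp[OF L bounded_linear_extend_index open_chart_image[OF man1 cp1_charts]])
qed (simp add: cinv_slice(2)[OF _ q])

lemma smooth_product_diff:
  "smooth_in_chart M z f \<Longrightarrow> x \<in> cdom M z \<Longrightarrow> diff_in_chart M z f x"
  by (simp add: smooth_in_chart_def diff_in_chart_def smooth_on_differentiable)

end

text \<open>A coordinate with index \<open>u i\<close> is a pullback from the first factor, so
  \<open>pd_pullback\<close> yields its row of the Jacobian; the differentiability it asks for is
  that of the transition maps of \<open>M1\<close>.\<close>

lemma jacobian_product:
  assumes "z \<in> charts M" "w \<in> charts M" "x \<in> cdom M z \<inter> cdom M w"
  shows "jacobian_mat M z w x $ u i $ u j = jacobian_mat M1 (cp1 z) (cp1 w) (pr1 x) $ i $ j"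
    and "jacobian_mat M z w x $ u i $ v k = 0"
proof -
  have c: "cp1 z \<in> charts M1" "cp1 w \<in> charts M1"
    "pr1 x \<in> cdom M1 (cp1 z) \<inter> cdom M1 (cp1 w)"
    using assms by (auto simp: charts_iff cdom_iff)
  then have "smooth_on (ccrd M1 (cp1 z) ` (cdom M1 (cp1 z) \<inter> cdom M1 (cp1 w)))
      (\<lambda>x. ccrd M1 (cp1 w) (cinv M1 (cp1 z) x))"
    using man1 by (auto simp: smooth_manifold_def)
  then have "(\<lambda>x. ccrd M1 (cp1 w) (cinv M1 (cp1 z) x)) differentiable (at (ccrd M1 (cp1 z) (pr1 x)))"
    using c by (intro smooth_on_differentiable) auto
  then have d: "diff_in_chart M1 (cp1 z) (\<lambda>p. ccrd M1 (cp1 w) p $ i) (pr1 x)"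
    unfolding diff_in_chart_def differentiable_def
    using bounded_linear.has_derivative[OF bounded_linear_vec_nth] by blast
  have "x \<in> cdom M z" using assms by simp
  note pd_pullback[OF assms(1) this d, of "\<lambda>q. ccrd M w q $ u i", OF ccrd_nth(1)]
  then show "jacobian_mat M z w x $ u i $ u j = jacobian_mat M1 (cp1 z) (cp1 w) (pr1 x) $ i $ j"
    "jacobian_mat M z w x $ u i $ v k = 0"
    by (simp_all add: jacobian_mat_def)
qed

lemma jacobian_product_vu:
  assumes "z \<in> charts M" "w \<in> charts M" "x \<in> cdom M z \<inter> cdom M w"
  shows "jacobian_mat M z w x $ v k $ u j = 0"
  by (rule product_atlas.jacobian_product(2)[OF swap_atlas assms])

end

section \<open>Parallel tractors on Einstein manifolds\<close>

lemma diff_in_chart_linear: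
  "bounded_linear L \<Longrightarrow> diff_in_chart M c f p \<Longrightarrow> diff_in_chart M c (\<lambda>q. L (f q)) p"
  unfolding diff_in_chart_def differentiable_def
  by (elim exE) (rule exI, erule (1) bounded_linear.has_derivative)

lemma pd_lincomb:
  fixes \<alpha> \<beta> :: real
  assumes "diff_in_chart M c f p" "diff_in_chart M c h p"
  shows "pd M c i (\<lambda>q. \<alpha> * f q + \<beta> * h q) p = \<alpha> * pd M c i f p + \<beta> * pd M c i h p"
proof -
  let ?f = "\<lambda>x. f (cinv M c x)" and ?h = "\<lambda>x. h (cinv M c x)" and ?x = "ccrd M c p"
  have "(?f has_derivative frechet_derivative ?f (at ?x)) (at ?x)"
    "(?h has_derivative frechet_derivative ?h (at ?x)) (at ?x)"
    using assms by (simp_all add: diff_in_chart_def flip: frechet_derivative_works)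
  from frechet_derivative_at[OF has_derivative_add[OF has_derivative_mult_right[OF this(1)]
    has_derivative_mult_right[OF this(2)]], of \<alpha> \<beta>]
  show ?thesis unfolding pd_def by (rule fun_cong[OF sym, THEN trans]) simp
qed

lemma diff_tractor_components:
  fixes M :: "('p, 'c, 'n::finite) atlas" and T :: "'c \<Rightarrow> 'p \<Rightarrow> real \<times> (real ^ 'b::finite) \<times> real"
  assumes "diff_in_chart M c (T c) p"
  shows "diff_in_chart M c (tr_sigma T c) p" "diff_in_chart M c (\<lambda>q. tr_mu T c q $ b) p"
    "diff_in_chart M c (tr_tau T c) p"
proof -
  have "bounded_linear (\<lambda>t :: real \<times> (real ^ 'b) \<times> real. fst t)"
    "bounded_linear (\<lambda>t :: real \<times> (real ^ 'b) \<times> real. fst (snd t) $ b)"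
    "bounded_linear (\<lambda>t :: real \<times> (real ^ 'b) \<times> real. snd (snd t))"
    using bounded_linear_fst bounded_linear_compose[OF bounded_linear_vec_nth
        bounded_linear_compose[OF bounded_linear_fst bounded_linear_snd]]
      bounded_linear_compose[OF bounded_linear_snd bounded_linear_snd]
    by simp_all
  from this[THEN diff_in_chart_linear, OF assms]
  show "diff_in_chart M c (tr_sigma T c) p" "diff_in_chart M c (\<lambda>q. tr_mu T c q $ b) p"
    "diff_in_chart M c (tr_tau T c) p" .
qed

text \<open>Connectedness of the manifold enters here: the functions \<open>h c\<close> glue to one
  function, which is locally constant because its coordinate derivatives vanish, and its level sets
  are therefore open and closed.\<close>

lemma constant_of_pd_zero:
  fixes M :: "('p, 'c, 'n::finite) atlas" and h :: "'c \<Rightarrow> 'p \<Rightarrow> real"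
  assumes M: "smooth_manifold M"
    and overlap: "\<And>c d p. c \<in> charts M \<Longrightarrow> d \<in> charts M \<Longrightarrow> p \<in> cdom M c \<Longrightarrow> p \<in> cdom M d \<Longrightarrow> h c p = h d p"
    and diff: "\<And>c p. c \<in> charts M \<Longrightarrow> p \<in> cdom M c \<Longrightarrow> diff_in_chart M c (h c) p"
    and zero: "\<And>c p i. c \<in> charts M \<Longrightarrow> p \<in> cdom M c \<Longrightarrow> pd M c i (h c) p = 0"
  obtains k where "\<And>c p. c \<in> charts M \<Longrightarrow> p \<in> cdom M c \<Longrightarrow> h c p = k"
proof -
  let ?X = "mtop M"
  \<comment> \<open>The choice of the chart is immaterial by \<open>overlap\<close>.\<close>
  define H where "H p = h (SOME c. c \<in> charts M \<and> p \<in> cdom M c) p" for p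
  have H: "H p = h c p" if "c \<in> charts M" "p \<in> cdom M c" for c p
    unfolding H_def using someI[of "\<lambda>c. c \<in> charts M \<and> p \<in> cdom M c" c] that
    by (intro overlap) auto
  have cover: "(\<Union>c\<in>charts M. cdom M c) = topspace ?X"
    using M by (auto simp: smooth_manifold_def)
  have loc: "\<exists>U. openin ?X U \<and> p \<in> U \<and> (\<forall>q\<in>U. H q = H p)" if top: "p \<in> topspace ?X" for p
  proof -
    obtain c where c: "c \<in> charts M" and p: "p \<in> cdom M c"
      using top[folded cover] by (rule UN_E)
    \<comment> \<open>Chart images need not be connected; a zero derivative forces constancy on a
      convex ball inside.\<close>
    obtain e where e: "e > 0" "ball (ccrd M c p) e \<subseteq> ccrd M c ` cdom M c"
      by (rule openE[OF open_chart_image[OF M c] imageI[OF p]])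
    let ?B = "ball (ccrd M c p) e" and ?h = "\<lambda>x. h c (cinv M c x)"
    have "(?h has_derivative (\<lambda>_. 0)) (at x within ?B)" if "x \<in> ?B" for x
    proof -
      obtain q where q: "q \<in> cdom M c" "x = ccrd M c q" using e \<open>x \<in> ?B\<close> by blast
      have d: "?h differentiable (at x)" using diff[OF c q(1)] by (simp add: diff_in_chart_def q)
      have "frechet_derivative ?h (at x) = (\<lambda>_. 0)"
      proof (rule linear_eq_stdbasis[OF linear_frechet_derivative[OF d] linear_zero])
        show "frechet_derivative ?h (at x) b = 0" if "b \<in> Basis" for b
          using that zero[OF c q(1)] by (auto simp: Basis_vec_def pd_def q)
      qed
      then have "(?h has_derivative (\<lambda>_. 0)) (at x)"
        using iffD1[OF frechet_derivative_works d] by simp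
      then show ?thesis by (rule has_derivative_at_withinI)
    qed
    then obtain k where k: "\<And>x. x \<in> ?B \<Longrightarrow> ?h x = k"
      using has_derivative_zero_constant[of ?B ?h] convex_ball by blast
    let ?U = "{q \<in> cdom M c. ccrd M c q \<in> ?B}"
    have "openin (subtopology ?X (cdom M c)) ?U"
    proof -
      have "topspace (subtopology ?X (cdom M c)) = cdom M c"
        using openin_subset[OF openin_cdom[OF M c]] by auto
      moreover have "openin (top_of_set (ccrd M c ` cdom M c)) ?B"
        using e by (simp add: openin_open_eq open_chart_image[OF M c])
      ultimately show ?thesis
        using openin_continuous_map_preimage[OF homeomorphic_imp_continuous_map[OF
          chart_homeomorphic[OF M c]], of ?B] by simp
    qed
    then have "openin ?X ?U" using openin_cdom[OF M c] by (rule openin_trans_full)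
    moreover have "H q = k" if "q \<in> ?U" for q
      using that k[of "ccrd M c q"] H[OF c] by (simp add: cinv_ccrd[OF M c])
    ultimately show ?thesis using e p by (intro exI[of _ ?U]) auto
  qed
  have "topspace ?X \<noteq> {}" using M unfolding smooth_manifold_def by (rule conjunct1)
  then obtain p0 where p0: "p0 \<in> topspace ?X" by blast
  let ?A = "{p \<in> topspace ?X. H p = H p0}"
  have "openin ?X ?A"
  proof (subst openin_subopen, intro ballI)
    fix p assume p: "p \<in> ?A"
    then obtain U where "openin ?X U" "p \<in> U" "\<forall>q\<in>U. H q = H p" using loc by blast
    then show "\<exists>T. openin ?X T \<and> p \<in> T \<and> T \<subseteq> ?A"
      using p openin_subset by (intro exI[of _ U]) fastforce
  qed
  moreover have "openin ?X (topspace ?X - ?A)"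
  proof (subst openin_subopen, intro ballI)
    fix p assume p: "p \<in> topspace ?X - ?A"
    then obtain U where "openin ?X U" "p \<in> U" "\<forall>q\<in>U. H q = H p" using loc by blast
    then show "\<exists>T. openin ?X T \<and> p \<in> T \<and> T \<subseteq> topspace ?X - ?A"
      using p openin_subset by (intro exI[of _ U]) fastforce
  qed
  ultimately have "openin ?X ?A" "closedin ?X ?A"
    unfolding closedin_def by auto
  moreover have "connected_space ?X" using M by (simp add: smooth_manifold_def)
  ultimately have "?A = {} \<or> ?A = topspace ?X"
    unfolding connected_space_clopen_in by blast
  then have "H p = H p0" if "p \<in> topspace ?X" for p using p0 that by auto
  moreover have "p \<in> topspace ?X" if "c \<in> charts M" "p \<in> cdom M c" for c p
    using that cover by blast
  ultimately show thesis using H by (intro that[of "H p0"]) fastforce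
qed

text \<open>The scalar curvature is parametrized by the number \<open>l\<close> for which
  \<open>P = l g\<close>. In dimension 1 the factor \<open>n - 1\<close> would leave
  \<open>l\<close> undetermined.\<close>

locale einstein_constant =
  fixes M :: "('p, 'c, 'n::finite) atlas" and g :: "('p, 'c, 'n) metric" and l :: real
  assumes einstein: "einstein_manifold M g (2 * l * real CARD('n) * (real CARD('n) - 1))"
    and card_ge_2: "CARD('n) \<ge> 2"
begin

lemma pseudo_riem: "pseudo_riemannian M g" and manifold: "smooth_manifold M"
  using einstein unfolding einstein_manifold_def pseudo_riemannian_def by blast+

text \<open>The Ricci tensor is \<open>2 l (n - 1) g\<close> and the trace correction is
  \<open>l n g\<close>; their difference is \<open>l (n - 2) g\<close>. In dimension 2 the scalar
  curvature is \<open>4 l\<close>, in agreement with the separate clause of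
  \<open>schouten\<close>.\<close>

lemma schouten_einstein:
  assumes "c \<in> charts M" "p \<in> cdom M c"
  shows "schouten M g c a b p = l * g c p $ a $ b"
proof -
  let ?n = "real CARD('n)"
  have s: "scalar_curvature M g c p = 2 * l * ?n * (?n - 1)"
    and r: "ricci M g c a b p = 1 / ?n * (2 * l * ?n * (?n - 1)) * g c p $ a $ b"
    using einstein assms unfolding einstein_manifold_def by auto
  show ?thesis
  proof (cases "CARD('n) = 2")
    case False
    then have n: "?n - 2 \<noteq> 0" "?n - 1 \<noteq> 0" "?n \<noteq> 0" using card_ge_2 by auto
    have "1 / ?n * (2 * l * ?n * (?n - 1)) = 2 * l * (?n - 1)" using n by simp
    moreover have "2 * l * ?n * (?n - 1) / (2 * (?n - 1)) = l * ?n"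
      using n nonzero_mult_div_cancel_right[of "2 * (?n - 1)" "l * ?n"] by (simp add: algebra_simps)
    moreover have "1 / (?n - 2) * (2 * l * (?n - 1) * x - l * ?n * x) = l * x" for x
      using n by (simp add: field_simps)
    ultimately show ?thesis using False by (simp only: schouten_def s r if_False)
  qed (simp add: schouten_def s)
qed

lemma metric_mult_inverse:
  assumes "c \<in> charts M" "p \<in> cdom M c"
  shows "(\<Sum>e\<in>UNIV. \<Sum>d\<in>UNIV. g c p $ a $ d * matrix_inv (g c p) $ d $ e * x $ e) = x $ a"
proof -
  have "invertible (g c p)"
    using metric_det_nonzero[OF pseudo_riem assms] by (simp add: invertible_det_nz)
  then have "((g c p ** matrix_inv (g c p)) *v x) $ a = x $ a"
    by (simp add: matrix_inv_mult)
  then show ?thesis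
    by (simp add: matrix_vector_mult_def matrix_matrix_mult_def sum_distrib_right)
qed

text \<open>With \<open>P = l g\<close> the inverse metric contracts away, leaving a system in which
  the Schouten tensor is present only through the number \<open>l\<close>.\<close>

lemma tractor_deriv_zero_iff:
  assumes c: "c \<in> charts M" "p \<in> cdom M c"
  shows "tractor_deriv M g T c a p = 0 \<longleftrightarrow>
    pd M c a (tr_sigma T c) p = tr_mu T c p $ a \<and>
    (\<forall>b. covector_deriv M g (tr_mu T) c a b p
         + (l * tr_sigma T c p + tr_tau T c p) * g c p $ a $ b = 0) \<and>
    pd M c a (tr_tau T c) p = l * tr_mu T c p $ a"
proof -
  have "(\<Sum>e\<in>UNIV. \<Sum>d\<in>UNIV. schouten M g c a d p * matrix_inv (g c p) $ d $ e * tr_mu T c p $ e)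
    = l * tr_mu T c p $ a"
    unfolding schouten_einstein[OF c] metric_mult_inverse[OF c, of a "tr_mu T c p", symmetric]
    by (simp add: sum_distrib_left mult.assoc)
  then show ?thesis
    by (simp add: tractor_deriv_def zero_prod_def vec_eq_iff schouten_einstein[OF c] algebra_simps)
qed

text \<open>This is the tractor of the Einstein metric \<open>g\<close> itself, with scale
  \<open>sigma = 1\<close>; its coefficient \<open>l sigma + tau\<close> vanishes.\<close>

lemma scale_tractor_parallel: "parallel_tractor M g (\<lambda>_ _. (1, 0, - l))"
  unfolding parallel_tractor_def tractor_section_def smooth_in_chart_def
  by (auto simp: tractor_deriv_zero_iff smooth_on_const covector_deriv_def pd_def)

text \<open>Evaluation at one point where \<open>T\<close> is nonzero suffices: the conditions
  \<open>tau = l sigma\<close> and \<open>tau = - l sigma\<close> meet only in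
  \<open>sigma = tau = 0\<close>.\<close>

lemma two_independent_of_parallel:
  assumes l: "l \<noteq> 0" and T: "parallel_tractor M g T"
    and tau: "\<And>c p. c \<in> charts M \<Longrightarrow> p \<in> cdom M c \<Longrightarrow> tr_tau T c p = l * tr_sigma T c p"
    and nz: "c \<in> charts M" "p \<in> cdom M c" "T c p \<noteq> 0"
  shows "two_independent_almost_einstein M g"
  unfolding two_independent_almost_einstein_def
proof (intro exI conjI)
  show "almost_einstein_structure M g (\<lambda>_ _. (1, 0, - l))" "almost_einstein_structure M g T"
    using scale_tractor_parallel T nz by (auto simp: almost_einstein_structure_def zero_prod_def)
  show "lin_indep_tractors M (\<lambda>_ _. (1, 0, - l)) T"
    unfolding lin_indep_tractors_def
  proof (intro allI impI)
    fix \<alpha> \<beta> :: real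
    assume "\<forall>c\<in>charts M. \<forall>p\<in>cdom M c. \<alpha> *\<^sub>R (1, 0, - l) + \<beta> *\<^sub>R T c p = 0"
    then have *: "\<alpha> *\<^sub>R (1, 0, - l) + \<beta> *\<^sub>R T c p = 0" using nz by blast
    obtain s m where Tcp: "T c p = (s, m, l * s)" using tau[OF nz(1,2)] by (metis prod.collapse)
    have "\<alpha> + \<beta> * s = 0" "- (\<alpha> * l) + \<beta> * (l * s) = 0"
      using * by (simp_all add: Tcp zero_prod_def)
    \<comment> \<open>\<open>\<beta> * s\<close> equals both \<open>- \<alpha>\<close> and
      \<open>\<alpha>\<close>.\<close>
    then have "\<alpha> + \<beta> * s = 0" "l * (\<beta> * s - \<alpha>) = 0" by (simp_all add: algebra_simps)
    with l have "\<alpha> = 0" by simp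
    moreover from this have "\<beta> *\<^sub>R T c p = 0" using * by (simp only: scaleR_zero_left add_0)
    ultimately show "\<alpha> = 0 \<and> \<beta> = 0" using nz(3) by simp
  qed
qed

lemma parallel_lincomb:
  assumes S: "parallel_tractor M g S" and T: "parallel_tractor M g T"
  shows "parallel_tractor M g (\<lambda>c p. \<alpha> *\<^sub>R S c p + \<beta> *\<^sub>R T c p)" (is "parallel_tractor M g ?R")
proof -
  have ST: "tractor_section M S" "tractor_section M T"
    using S T by (auto simp: parallel_tractor_def)
  have sec: "tractor_section M ?R"
    unfolding tractor_section_def
  proof (intro conjI ballI)
    fix c assume c: "c \<in> charts M"
    have "smooth_in_chart M c (\<lambda>p. \<alpha> *\<^sub>R S c p)" "smooth_in_chart M c (\<lambda>p. \<beta> *\<^sub>R T c p)"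
      using ST c by (auto simp: tractor_section_def
          intro!: smooth_in_chart_linear[OF manifold c bounded_linear_scaleR_right])
    then show "smooth_in_chart M c (?R c)"
      unfolding smooth_in_chart_def by (intro smooth_on_add[OF open_chart_image[OF manifold c]])
  next
    fix c d p assume cd: "c \<in> charts M" "d \<in> charts M" "p \<in> cdom M c \<inter> cdom M d"
    have "tr_sigma S c p = tr_sigma S d p" "tr_mu S c p = transpose (jacobian_mat M c d p) *v tr_mu S d p"
      "tr_tau S c p = tr_tau S d p" "tr_sigma T c p = tr_sigma T d p"
      "tr_mu T c p = transpose (jacobian_mat M c d p) *v tr_mu T d p" "tr_tau T c p = tr_tau T d p"
      using ST cd unfolding tractor_section_def by blast+
    then show "tr_sigma ?R c p = tr_sigma ?R d p"
      "tr_mu ?R c p = transpose (jacobian_mat M c d p) *v tr_mu ?R d p"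
      "tr_tau ?R c p = tr_tau ?R d p"
      by (simp_all only: fst_add snd_add fst_scaleR snd_scaleR matrix_vector_right_distrib
          matrix_vector_mult_scaleR)
  qed
  have "tractor_deriv M g ?R c a p = 0" if c: "c \<in> charts M" "p \<in> cdom M c" for c a p
  proof -
    have "diff_in_chart M c (S c) p" "diff_in_chart M c (T c) p"
      using ST c by (auto simp: tractor_section_def intro: smooth_in_chart_diff[OF manifold])
    note d = diff_tractor_components[of _ _ S, OF this(1)] diff_tractor_components[of _ _ T, OF this(2)]
    have "tractor_deriv M g S c a p = 0" "tractor_deriv M g T c a p = 0"
      using S T c by (auto simp: parallel_tractor_def)
    then have
      s: "pd M c a (tr_sigma S c) p = tr_mu S c p $ a" "pd M c a (tr_sigma T c) p = tr_mu T c p $ a" and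
      m: "covector_deriv M g (tr_mu S) c a b p + (l * tr_sigma S c p + tr_tau S c p) * g c p $ a $ b = 0"
         "covector_deriv M g (tr_mu T) c a b p + (l * tr_sigma T c p + tr_tau T c p) * g c p $ a $ b = 0"
      and t: "pd M c a (tr_tau S c) p = l * tr_mu S c p $ a" "pd M c a (tr_tau T c) p = l * tr_mu T c p $ a"
      for b using c by (auto simp: tractor_deriv_zero_iff)
    have cov: "covector_deriv M g (tr_mu ?R) c a b p =
        \<alpha> * covector_deriv M g (tr_mu S) c a b p + \<beta> * covector_deriv M g (tr_mu T) c a b p" for b
      by (simp add: covector_deriv_def pd_lincomb[OF d(2) d(5)] sum.distrib sum_distrib_left
          algebra_simps)
    have "covector_deriv M g (tr_mu ?R) c a b p +
        (l * tr_sigma ?R c p + tr_tau ?R c p) * g c p $ a $ b =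
      \<alpha> * (covector_deriv M g (tr_mu S) c a b p + (l * tr_sigma S c p + tr_tau S c p) * g c p $ a $ b)
      + \<beta> * (covector_deriv M g (tr_mu T) c a b p + (l * tr_sigma T c p + tr_tau T c p) * g c p $ a $ b)"
      for b unfolding cov by (simp add: algebra_simps)
    then have "covector_deriv M g (tr_mu ?R) c a b p +
        (l * tr_sigma ?R c p + tr_tau ?R c p) * g c p $ a $ b = 0" for b
      by (simp only: m mult_zero_right add_0)
    moreover have "pd M c a (tr_sigma ?R c) p = tr_mu ?R c p $ a"
      "pd M c a (tr_tau ?R c) p = l * tr_mu ?R c p $ a"
      using pd_lincomb[OF d(1) d(4)] pd_lincomb[OF d(3) d(6)] by (simp_all add: s t algebra_simps)
    ultimately show ?thesis using tractor_deriv_zero_iff[OF c, of ?R a] by blast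
  qed
  with sec show ?thesis by (simp add: parallel_tractor_def)
qed

text \<open>Both \<open>d tau\<close> and \<open>l d sigma\<close> are equal to
  \<open>l mu\<close>.\<close>

lemma parallel_tau_sigma_constant:
  assumes T: "parallel_tractor M g T"
  shows "\<exists>k. \<forall>c\<in>charts M. \<forall>p\<in>cdom M c. tr_tau T c p = l * tr_sigma T c p + k"
proof -
  have sec: "tractor_section M T" using T by (simp add: parallel_tractor_def)
  have d: "diff_in_chart M c (T c) p" if "c \<in> charts M" "p \<in> cdom M c" for c p
    using sec that by (auto simp: tractor_section_def intro: smooth_in_chart_diff[OF manifold])
  \<comment> \<open>Written as a linear combination with explicit coefficients, as in
    \<open>pd_lincomb\<close>.\<close>
  let ?h = "\<lambda>c p. 1 * tr_tau T c p + (- l) * tr_sigma T c p"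
  obtain k where k: "\<And>c p. c \<in> charts M \<Longrightarrow> p \<in> cdom M c \<Longrightarrow> ?h c p = k"
  proof (rule constant_of_pd_zero[OF manifold, of ?h])
    show "?h c p = ?h d p" if "c \<in> charts M" "d \<in> charts M" "p \<in> cdom M c" "p \<in> cdom M d" for c d p
    proof -
      have "tr_sigma T c p = tr_sigma T d p" "tr_tau T c p = tr_tau T d p"
        using sec that unfolding tractor_section_def by blast+
      then show ?thesis by simp
    qed
  next
    fix c p i assume c: "c \<in> charts M" "p \<in> cdom M c"
    have "bounded_linear (\<lambda>t :: real \<times> (real ^ 'n) \<times> real. 1 * snd (snd t) + (- l) * fst t)"
      by (intro bounded_linear_intros)
    from diff_in_chart_linear[OF this d[OF c]] show "diff_in_chart M c (?h c) p" .
    have "tractor_deriv M g T c i p = 0" using T c by (auto simp: parallel_tractor_def)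
    then show "pd M c i (?h c) p = 0"
      unfolding pd_lincomb[OF diff_tractor_components(3)[of M c T, OF d[OF c]]
        diff_tractor_components(1)[of M c T, OF d[OF c]]]
      by (simp add: tractor_deriv_zero_iff[OF c])
  qed blast
  show ?thesis by (intro exI[of _ k] ballI) (use k in fastforce)
qed

text \<open>The constant \<open>tau - l sigma\<close> is a linear functional on parallel tractors,
  so it has a nontrivial kernel on a space of dimension two.\<close>

lemma two_independent_imp_parallel:
  assumes "two_independent_almost_einstein M g"
  obtains T c p where "parallel_tractor M g T" "c \<in> charts M" "p \<in> cdom M c" "T c p \<noteq> 0"
    "\<And>c p. c \<in> charts M \<Longrightarrow> p \<in> cdom M c \<Longrightarrow> tr_tau T c p = l * tr_sigma T c p"
proof -
  obtain S T where S: "parallel_tractor M g S" and T: "parallel_tractor M g T"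
    and ind: "lin_indep_tractors M S T"
    using assms by (auto simp: two_independent_almost_einstein_def almost_einstein_structure_def)
  obtain s where s: "\<And>c p. c \<in> charts M \<Longrightarrow> p \<in> cdom M c \<Longrightarrow> tr_tau S c p = l * tr_sigma S c p + s"
    using parallel_tau_sigma_constant[OF S] by blast
  obtain t where t: "\<And>c p. c \<in> charts M \<Longrightarrow> p \<in> cdom M c \<Longrightarrow> tr_tau T c p = l * tr_sigma T c p + t"
    using parallel_tau_sigma_constant[OF T] by blast
  obtain \<alpha> \<beta> :: real where ab: "\<alpha> * s + \<beta> * t = 0" "\<not> (\<alpha> = 0 \<and> \<beta> = 0)"
  proof (cases "t = 0")
    case True
    show ?thesis by (cases "s = 0") (use True in \<open>auto intro: that[of 1 0] that[of 0 1]\<close>)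
  next
    case False
    then show ?thesis by (intro that[of t "- s"]) auto
  qed
  let ?R = "\<lambda>c p. \<alpha> *\<^sub>R S c p + \<beta> *\<^sub>R T c p"
  obtain c p where "c \<in> charts M" "p \<in> cdom M c" "?R c p \<noteq> 0"
    using ind ab(2) unfolding lin_indep_tractors_def by blast
  moreover have "tr_tau ?R c p = l * tr_sigma ?R c p" if "c \<in> charts M" "p \<in> cdom M c" for c p
  proof -
    have "tr_tau ?R c p = l * tr_sigma ?R c p + (\<alpha> * s + \<beta> * t)"
      by (simp add: s[OF that] t[OF that] algebra_simps)
    then show ?thesis by (simp add: ab)
  qed
  ultimately show thesis using that parallel_lincomb[OF S T] by blast
qed

end

section \<open>Curvature of the product\<close>

locale product_einstein = product_atlas u v M M1 M2 pr1 pr2 mk cp1 cp2 mkc +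
  F1: einstein_constant M1 g1 l1 + F2: einstein_constant M2 g2 l2
  for u :: "'n1::finite \<Rightarrow> 'm::finite" and v :: "'n2::finite \<Rightarrow> 'm"
    and M :: "('p, 'c, 'm) atlas" and M1 :: "('p1, 'c1, 'n1) atlas" and M2 :: "('p2, 'c2, 'n2) atlas"
    and pr1 pr2 mk cp1 cp2 mkc g1 l1 g2 l2 +
  fixes g :: "('p, 'c, 'm) metric"
  assumes metric_uu: "g z x $ u a $ u b = g1 (cp1 z) (pr1 x) $ a $ b"
    and metric_vv: "g z x $ v a' $ v b' = g2 (cp2 z) (pr2 x) $ a' $ b'"
    and metric_uv: "g z x $ u a $ v b' = 0" and metric_vu: "g z x $ v b' $ u a = 0"
    and opposite: "l1 + l2 = 0" and nonzero: "l1 \<noteq> 0" "l2 \<noteq> 0"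
begin

lemma swap_einstein: "product_einstein v u M M2 M1 pr2 pr1 (\<lambda>q p. mk p q) cp2 cp1 (\<lambda>d c. mkc c d)
  g2 l2 g1 l1 g"
  using opposite nonzero
  by (intro product_einstein.intro swap_atlas product_einstein_axioms.intro
      F1.einstein_constant_axioms F2.einstein_constant_axioms metric_uu metric_vv metric_uv metric_vu)
    simp_all

context
  fixes z assumes z: "z \<in> charts M"
begin

lemma metric_inverse:
  assumes "x \<in> cdom M z"
  shows "matrix_inv (g z x) $ u a $ u b = matrix_inv (g1 (cp1 z) (pr1 x)) $ a $ b"
    and "matrix_inv (g z x) $ u a $ v b' = 0" and "matrix_inv (g z x) $ v b' $ u a = 0"
proof -
  have "invertible (g1 (cp1 z) (pr1 x))" "invertible (g2 (cp2 z) (pr2 x))"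
    using assms metric_det_nonzero[OF F1.pseudo_riem cp1_charts[OF z]]
      metric_det_nonzero[OF F2.pseudo_riem cp2_charts[OF z]]
    by (auto simp: cdom_iff invertible_det_nz)
  from matrix_inv_block[OF metric_uu metric_vv metric_uv metric_vu this]
  show "matrix_inv (g z x) $ u a $ u b = matrix_inv (g1 (cp1 z) (pr1 x)) $ a $ b"
    "matrix_inv (g z x) $ u a $ v b' = 0" "matrix_inv (g z x) $ v b' $ u a = 0" .
qed

lemma pd_metric:
  assumes x: "x \<in> cdom M z"
  shows "pd M z (u i) (\<lambda>y. g z y $ u a $ u b) x = pd M1 (cp1 z) i (\<lambda>p. g1 (cp1 z) p $ a $ b) (pr1 x)"
    and "pd M z (v j) (\<lambda>y. g z y $ u a $ u b) x = 0"
    and "pd M z k (\<lambda>y. g z y $ u a $ v b') x = 0"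
    and "pd M z k (\<lambda>y. g z y $ v b' $ u a) x = 0"
proof -
  have "diff_in_chart M1 (cp1 z) (\<lambda>p. g1 (cp1 z) p $ a $ b) (pr1 x)"
    using x by (intro smooth_in_chart_diff[OF man1 cp1_charts[OF z]]
        smooth_metric_component[OF F1.pseudo_riem cp1_charts[OF z]]) (simp add: cdom_iff)
  from pd_pullback[OF z x this, of "\<lambda>y. g z y $ u a $ u b", OF metric_uu]
  show "pd M z (u i) (\<lambda>y. g z y $ u a $ u b) x = pd M1 (cp1 z) i (\<lambda>p. g1 (cp1 z) p $ a $ b) (pr1 x)"
    "pd M z (v j) (\<lambda>y. g z y $ u a $ u b) x = 0" .
qed (simp_all add: pd_def metric_uv metric_vu)

lemma christoffel_uuu:
  assumes x: "x \<in> cdom M z"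
  shows "christoffel M g z (u k) (u i) (u j) x = christoffel M1 g1 (cp1 z) k i j (pr1 x)"
  by (simp add: christoffel_def sum_split metric_inverse[OF x] pd_metric[OF x])

lemma christoffel_mixed:
  assumes x: "x \<in> cdom M z"
  shows "christoffel M g z (v k') (u i) (u j) x = 0"
    and "christoffel M g z (u k) (u i) (v j') x = 0"
    and "christoffel M g z (u k) (v j') (u i) x = 0"
  by (simp_all add: christoffel_def sum_split metric_inverse[OF x] pd_metric[OF x])

end

text \<open>The facts for the second factor, by exchange of the factors. They are recorded stage by
  stage because every sum over product indices in the next stage needs both halves.\<close>

lemmas christoffel_vvv = product_einstein.christoffel_uuu[OF swap_einstein]
lemmas christoffel_mixed' = product_einstein.christoffel_mixed[OF swap_einstein]

context
  fixes z assumes z: "z \<in> charts M"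
begin

lemmas christoffel_simps = christoffel_uuu[OF z] christoffel_mixed[OF z] christoffel_vvv[OF z]
  christoffel_mixed'[OF z]

text \<open>Mixed symbols vanish on the whole chart domain, hence so do their derivatives. A pure
  symbol is a pullback, and its chain rule rests on \<open>diff_christoffel\<close>.\<close>

lemma pd_christoffel:
  assumes x: "x \<in> cdom M z"
  shows "pd M z (u l) (christoffel M g z (u k) (u i) (u j)) x =
      pd M1 (cp1 z) l (christoffel M1 g1 (cp1 z) k i j) (pr1 x)"
    and "pd M z (v l') (christoffel M g z (u k) (u i) (u j)) x = 0"
    and "pd M z s (christoffel M g z (v k') (u i) (u j)) x = 0"
    and "pd M z s (christoffel M g z (u k) (u i) (v j')) x = 0"
    and "pd M z s (christoffel M g z (u k) (v j') (u i)) x = 0"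
proof -
  have "diff_in_chart M1 (cp1 z) (christoffel M1 g1 (cp1 z) k i j) (pr1 x)"
    using x by (intro diff_christoffel[OF F1.pseudo_riem cp1_charts[OF z]]) (simp add: cdom_iff)
  from pd_pullback[OF z x this, of "christoffel M g z (u k) (u i) (u j)", OF christoffel_uuu[OF z]]
  show "pd M z (u l) (christoffel M g z (u k) (u i) (u j)) x =
      pd M1 (cp1 z) l (christoffel M1 g1 (cp1 z) k i j) (pr1 x)"
    "pd M z (v l') (christoffel M g z (u k) (u i) (u j)) x = 0" by blast+
qed (rule pd_product_zero[OF z x], simp add: christoffel_simps)+

end

lemmas pd_christoffel' = product_einstein.pd_christoffel[OF swap_einstein]

context
  fixes z x assumes z: "z \<in> charts M" and x: "x \<in> cdom M z"
begin

lemma ricci_uu: "ricci M g z (u a) (u b) x = ricci M1 g1 (cp1 z) a b (pr1 x)"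
  by (simp add: ricci_def riemann_def sum_split christoffel_simps[OF z] x
      pd_christoffel[OF z x] pd_christoffel'[OF z x])

lemma ricci_uv: "ricci M g z (u a) (v b) x = 0"
  by (simp add: ricci_def riemann_def sum_split christoffel_simps[OF z] x
      pd_christoffel[OF z x] pd_christoffel'[OF z x])

end

lemmas ricci_vv = product_einstein.ricci_uu[OF swap_einstein]
lemmas ricci_vu = product_einstein.ricci_uv[OF swap_einstein]
lemmas metric_inverse_swap = product_einstein.metric_inverse[OF swap_einstein]

section \<open>Schouten tensor and tractor connection of the product\<close>

context
  fixes z x assumes z: "z \<in> charts M" and x: "x \<in> cdom M z"
begin

text \<open>With \<open>l2 = - l1\<close> the sum of the two scalar curvatures factors by
  \<open>m (m - 1) - n (n - 1) = (m - n) (m + n - 1)\<close>; the last factor cancels against the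
  denominator in the Schouten tensor.\<close>

lemma scalar_curvature_product:
  "scalar_curvature M g z x =
    2 * l1 * (real CARD('n1) - real CARD('n2)) * (real CARD('n1) + real CARD('n2) - 1)"
proof -
  have p: "pr1 x \<in> cdom M1 (cp1 z)" "pr2 x \<in> cdom M2 (cp2 z)" using x by (auto simp: cdom_iff)
  have "scalar_curvature M g z x =
      scalar_curvature M1 g1 (cp1 z) (pr1 x) + scalar_curvature M2 g2 (cp2 z) (pr2 x)"
    by (simp add: scalar_curvature_def sum_split ricci_uu[OF z x] ricci_uv[OF z x] ricci_vv[OF z x]
        ricci_vu[OF z x] metric_inverse[OF z x] metric_inverse_swap[OF z x])
  also have "\<dots> = 2 * l1 * real CARD('n1) * (real CARD('n1) - 1)
      + 2 * l2 * real CARD('n2) * (real CARD('n2) - 1)"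
    using F1.einstein F2.einstein p cp1_charts[OF z] cp2_charts[OF z] unfolding einstein_manifold_def by simp
  also have "l2 = - l1" using opposite by simp
  finally show ?thesis by (simp add: algebra_simps)
qed

text \<open>The identity behind this is \<open>2 (m - 1) - (m - n) = m + n - 2\<close>, where
  \<open>m - n\<close> comes from the opposite signs of \<open>l1\<close> and
  \<open>l2\<close>.\<close>

lemma schouten_uu: "schouten M g z (u a) (u b) x = l1 * g1 (cp1 z) (pr1 x) $ a $ b"
proof -
  let ?m = "real CARD('n1)" and ?n = "real CARD('n2)" and ?y = "g1 (cp1 z) (pr1 x) $ a $ b"
  have mn: "?m \<ge> 2" "?n \<ge> 2" using F1.card_ge_2 F2.card_ge_2 by auto
  have p: "pr1 x \<in> cdom M1 (cp1 z)" using x by (auto simp: cdom_iff)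
  have "ricci M1 g1 (cp1 z) a b (pr1 x) = 1 / ?m * (2 * l1 * ?m * (?m - 1)) * ?y"
    using F1.einstein p cp1_charts[OF z] unfolding einstein_manifold_def by simp
  also have "1 / ?m * (2 * l1 * ?m * (?m - 1)) = 2 * l1 * (?m - 1)" using mn by simp
  finally have r: "ricci M g z (u a) (u b) x = 2 * l1 * (?m - 1) * ?y"
    by (simp add: ricci_uu[OF z x])
  have "2 * l1 * (?m - ?n) * (?m + ?n - 1) / (2 * (?m + ?n - 1)) = l1 * (?m - ?n)"
    using mn nonzero_mult_div_cancel_right[of "2 * (?m + ?n - 1)" "l1 * (?m - ?n)"]
    by (simp add: algebra_simps)
  moreover have "1 / (?m + ?n - 2) * (2 * l1 * (?m - 1) * y - l1 * (?m - ?n) * y) = l1 * y" for y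
    using mn by (simp add: field_simps)
  \<comment> \<open>The product has dimension at least 4, so the generic clause of
    \<open>schouten\<close> applies even to two surfaces.\<close>
  moreover have "CARD('m) \<noteq> 2" using mn by (simp add: card_split)
  ultimately show ?thesis
    by (simp only: schouten_def r scalar_curvature_product metric_uu if_False card_split of_nat_add)
qed

lemma schouten_uv: "schouten M g z (u a) (v b) x = 0"
proof -
  have "CARD('m) \<noteq> 2" using F1.card_ge_2 F2.card_ge_2 by (simp add: card_split)
  then show ?thesis by (simp add: schouten_def ricci_uv[OF z x] metric_uv)
qed

text \<open>Along the first factor the product equation is the one of \<open>M1\<close> for
  \<open>sigma\<close>, the \<open>u\<close>-part of \<open>mu\<close>, and \<open>tau\<close>.
  Since the mixed parts of metric, Christoffel symbols and Schouten tensor vanish, the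
  \<open>v\<close>-part of \<open>mu\<close> only has to be constant in these directions.\<close>

lemma tractor_deriv_u:
  "tractor_deriv M g T z (u a) x = 0 \<longleftrightarrow>
    pd M z (u a) (tr_sigma T z) x = tr_mu T z x $ u a \<and>
    (\<forall>b. pd M z (u a) (\<lambda>y. tr_mu T z y $ u b) x
         - (\<Sum>k\<in>UNIV. christoffel M1 g1 (cp1 z) k a b (pr1 x) * tr_mu T z x $ u k)
         + (l1 * tr_sigma T z x + tr_tau T z x) * g1 (cp1 z) (pr1 x) $ a $ b = 0) \<and>
    (\<forall>b. pd M z (u a) (\<lambda>y. tr_mu T z y $ v b) x = 0) \<and>
    pd M z (u a) (tr_tau T z) x = l1 * tr_mu T z x $ u a"
proof -
  have p: "pr1 x \<in> cdom M1 (cp1 z)" using x by (auto simp: cdom_iff)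
  have "(\<Sum>e\<in>UNIV. \<Sum>d\<in>UNIV. schouten M g z (u a) d x * matrix_inv (g z x) $ d $ e * tr_mu T z x $ e)
    = l1 * (\<Sum>e\<in>UNIV. \<Sum>d\<in>UNIV. g1 (cp1 z) (pr1 x) $ a $ d * matrix_inv (g1 (cp1 z) (pr1 x)) $ d $ e
        * restrict_index u (tr_mu T z x) $ e)"
    by (simp add: sum_split schouten_uu schouten_uv metric_inverse[OF z x] sum_distrib_left mult.assoc)
  also have "\<dots> = l1 * tr_mu T z x $ u a"
    unfolding F1.metric_mult_inverse[OF cp1_charts[OF z] p] by simp
  finally show ?thesis
    by (simp add: tractor_deriv_def zero_prod_def vec_eq_iff all_index covector_deriv_def sum_split
        christoffel_simps[OF z x] schouten_uu schouten_uv metric_uu metric_uv algebra_simps)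
qed

end

lemmas tractor_deriv_v = product_einstein.tractor_deriv_u[OF swap_einstein]

end

section \<open>Parallel tractors on the product\<close>

text \<open>Restriction of \<open>mu\<close>, combined with subtracting from
  \<open>(sigma, tau)\<close> its component along \<open>(1, -l)\<close>, whose coefficient is
  \<open>(sigma - tau / l) / 2\<close>.\<close>

definition slice_map :: "('n::finite \<Rightarrow> 'm::finite) \<Rightarrow> real \<Rightarrow> real \<times> (real ^ 'm) \<times> real \<Rightarrow> real \<times> (real ^ 'n) \<times> real" where
  "slice_map u l t = (1 / 2 * fst t + 1 / (2 * l) * snd (snd t), restrict_index u (fst (snd t)),
     l / 2 * fst t + 1 / 2 * snd (snd t))"

definition pullback_map :: "('n::finite \<Rightarrow> 'm::finite) \<Rightarrow> real \<times> (real ^ 'n) \<times> real \<Rightarrow> real \<times> (real ^ 'm) \<times> real" where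
  "pullback_map u t = (fst t, extend_index u (fst (snd t)), snd (snd t))"

lemma bounded_linear_slice_map: "bounded_linear (slice_map u l)"
  unfolding linear_conv_bounded_linear[symmetric]
  by (rule linearI) (simp_all add: slice_map_def vec_eq_iff add_divide_distrib algebra_simps)

lemma bounded_linear_pullback_map: "bounded_linear (pullback_map u)"
  unfolding linear_conv_bounded_linear[symmetric]
  by (rule linearI) (simp_all add: pullback_map_def extend_index_def vec_eq_iff algebra_simps)

context product_einstein
begin

text \<open>The restricted triple already solves the equations of \<open>M1\<close> by
  \<open>tractor_deriv_u\<close>; the projection in \<open>slice_map\<close> respects them and
  enforces \<open>tau = l1 sigma\<close>.\<close>

lemma parallel_slice:
  assumes T: "parallel_tractor M g T" and d: "d \<in> charts M2" and q: "q \<in> cdom M2 d"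
  shows "parallel_tractor M1 g1 (\<lambda>c p. slice_map u l1 (T (mkc c d) (mk p q)))"
    (is "parallel_tractor M1 g1 ?S")
proof -
  have sec: "tractor_section M T" using T by (simp add: parallel_tractor_def)
  have z: "mkc c d \<in> charts M" if "c \<in> charts M1" for c
    using that d by (simp add: charts_iff cp_mkc)
  have x: "mk p q \<in> cdom M (mkc c d)" if "p \<in> cdom M1 c" for c p
    using that q by (simp add: cdom_iff cp_mkc pr_mk)
  have smooth: "smooth_in_chart M (mkc c d) (T (mkc c d))" if "c \<in> charts M1" for c
    using sec z[OF that] by (simp add: tractor_section_def)
  have S: "tractor_section M1 ?S"
    unfolding tractor_section_def
  proof (intro conjI ballI)
    show "smooth_in_chart M1 c (?S c)" if "c \<in> charts M1" for c
      using smooth_slice[OF z[OF that] smooth[OF that] bounded_linear_slice_map, of q u l1] q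
      by (simp add: cp_mkc)
  next
    fix c c' p assume c: "c \<in> charts M1" "c' \<in> charts M1" "p \<in> cdom M1 c \<inter> cdom M1 c'"
    let ?z = "mkc c d" and ?w = "mkc c' d" and ?x = "mk p q"
    have x': "?x \<in> cdom M ?z \<inter> cdom M ?w" using c x by simp
    have eq: "tr_sigma T ?z ?x = tr_sigma T ?w ?x" "tr_tau T ?z ?x = tr_tau T ?w ?x"
      "tr_mu T ?z ?x = transpose (jacobian_mat M ?z ?w ?x) *v tr_mu T ?w ?x"
      using sec z[OF c(1)] z[OF c(2)] x' unfolding tractor_section_def by blast+
    show "tr_sigma ?S c p = tr_sigma ?S c' p" "tr_tau ?S c p = tr_tau ?S c' p"
      by (simp_all add: slice_map_def eq(1,2))
    \<comment> \<open>The Jacobian is block diagonal, so the \<open>v\<close>-part of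
      \<open>mu\<close> does not contribute.\<close>
    have "tr_mu T ?z ?x $ u a =
        (transpose (jacobian_mat M1 c c' p) *v restrict_index u (tr_mu T ?w ?x)) $ a" for a
      using jacobian_product(1)[OF z[OF c(1)] z[OF c(2)] x']
        jacobian_product_vu[OF z[OF c(1)] z[OF c(2)] x']
      unfolding eq(3) by (simp add: matrix_vector_mult_def transpose_def sum_split cp_mkc pr_mk)
    then show "tr_mu ?S c p = transpose (jacobian_mat M1 c c' p) *v tr_mu ?S c' p"
      by (simp add: slice_map_def vec_eq_iff)
  qed
  have "tractor_deriv M1 g1 ?S c a p = 0" if c: "c \<in> charts M1" "p \<in> cdom M1 c" for c a p
  proof -
    let ?z = "mkc c d" and ?x = "mk p q"
    have "diff_in_chart M ?z (T ?z) ?x"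
      by (rule smooth_product_diff[OF z[OF c(1)] smooth[OF c(1)] x[OF c(2)]])
    note diffs = diff_tractor_components[of M ?z T, OF this]
    have pd: "pd M1 c a (\<lambda>p. f (mk p q)) p = pd M ?z (u a) f ?x" if "diff_in_chart M ?z f ?x" for f
      using pd_slice[OF z[OF c(1)], of p q f a] that c q by (simp add: cp_mkc)
    have lin: "pd M1 c a (\<lambda>p. \<alpha> * tr_sigma T ?z (mk p q) + \<beta> * tr_tau T ?z (mk p q)) p =
        \<alpha> * pd M ?z (u a) (tr_sigma T ?z) ?x + \<beta> * pd M ?z (u a) (tr_tau T ?z) ?x" for \<alpha> \<beta>
    proof -
      have "bounded_linear (\<lambda>t :: real \<times> (real ^ 'm) \<times> real. \<alpha> * fst t + \<beta> * snd (snd t))"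
        unfolding linear_conv_bounded_linear[symmetric]
        by (rule linearI) (simp_all add: algebra_simps)
      from pd[OF diff_in_chart_linear[OF this smooth_product_diff[OF z[OF c(1)] smooth[OF c(1)] x[OF c(2)]]]]
      show ?thesis unfolding pd_lincomb[OF diffs(1,3)] .
    qed
    have "tractor_deriv M g T ?z (u a) ?x = 0"
      using T z[OF c(1)] x[OF c(2)] by (simp add: parallel_tractor_def)
    then have eqs: "pd M ?z (u a) (tr_sigma T ?z) ?x = tr_mu T ?z ?x $ u a"
      "pd M ?z (u a) (\<lambda>y. tr_mu T ?z y $ u b) ?x
         - (\<Sum>k\<in>UNIV. christoffel M1 g1 c k a b p * tr_mu T ?z ?x $ u k)
         + (l1 * tr_sigma T ?z ?x + tr_tau T ?z ?x) * g1 c p $ a $ b = 0"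
      "pd M ?z (u a) (tr_tau T ?z) ?x = l1 * tr_mu T ?z ?x $ u a" for b
      by (simp_all add: tractor_deriv_u[OF z[OF c(1)] x[OF c(2)]] cp_mkc pr_mk)
    have "l1 * tr_sigma ?S c p + tr_tau ?S c p = l1 * tr_sigma T ?z ?x + tr_tau T ?z ?x"
      using nonzero by (simp add: slice_map_def field_simps)
    then have "covector_deriv M1 g1 (tr_mu ?S) c a b p
        + (l1 * tr_sigma ?S c p + tr_tau ?S c p) * g1 c p $ a $ b = 0" for b
      using eqs(2)[of b] pd[OF diffs(2), of "u b"] by (simp add: covector_deriv_def slice_map_def)
    moreover have "pd M1 c a (tr_sigma ?S c) p = tr_mu ?S c p $ a"
    proof -
      \<comment> \<open>Half of \<open>d sigma = mu\<close> and half of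
        \<open>d tau / l1 = mu\<close> add up to \<open>mu\<close>.\<close>
      have "1 / 2 * y + 1 / (2 * l1) * (l1 * y) = y" for y using nonzero by (simp add: field_simps)
      then show ?thesis by (simp only: slice_map_def lin eqs(1,3) fst_conv snd_conv restrict_index_nth)
    qed
    moreover have "pd M1 c a (tr_tau ?S c) p = l1 * tr_mu ?S c p $ a"
      by (simp add: slice_map_def lin eqs(1,3) del: times_divide_eq_left)
    ultimately show ?thesis using F1.tractor_deriv_zero_iff[OF c, of ?S a] by blast
  qed
  with S show ?thesis by (simp add: parallel_tractor_def)
qed

lemma two_independent_of_slice:
  assumes T: "parallel_tractor M g T" and z: "z \<in> charts M" and x: "x \<in> cdom M z"
    and nz: "slice_map u l1 (T z x) \<noteq> 0"
  shows "two_independent_almost_einstein M1 g1"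
proof (rule F1.two_independent_of_parallel[OF nonzero(1)])
  show "parallel_tractor M1 g1 (\<lambda>c p. slice_map u l1 (T (mkc c (cp2 z)) (mk p (pr2 x))))"
    using z x by (intro parallel_slice T) (auto simp: charts_iff cdom_iff)
  show "cp1 z \<in> charts M1" "pr1 x \<in> cdom M1 (cp1 z)"
    using z x by (auto simp: charts_iff cdom_iff)
  show "slice_map u l1 (T (mkc (cp1 z) (cp2 z)) (mk (pr1 x) (pr2 x))) \<noteq> 0"
    using nz by (simp add: cp_mkc pr_mk)
  show "tr_tau (\<lambda>c p. slice_map u l1 (T (mkc c (cp2 z)) (mk p (pr2 x)))) c p =
      l1 * tr_sigma (\<lambda>c p. slice_map u l1 (T (mkc c (cp2 z)) (mk p (pr2 x)))) c p" for c p
    using nonzero by (simp add: slice_map_def field_simps)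
qed

text \<open>The two scalar conditions are \<open>l1 sigma + tau = 0\<close> and
  \<open>- l1 sigma + tau = 0\<close>, independent because \<open>l1\<close> is nonzero; the two
  halves of \<open>mu\<close> are covered by \<open>u\<close> and \<open>v\<close>.\<close>

lemma slice_maps_zero:
  assumes "slice_map u l1 t = 0" "slice_map v l2 t = 0"
  shows "t = 0"
proof -
  have l2: "l2 = - l1" using opposite by simp
  have "l1 * fst t + snd (snd t) = 0" "l2 * fst t + snd (snd t) = 0"
    "restrict_index u (fst (snd t)) = 0" "restrict_index v (fst (snd t)) = 0"
    using assms by (simp_all add: slice_map_def zero_prod_def field_simps)
  then have "l1 * fst t = 0" "snd (snd t) = 0" "fst (snd t) = 0"
    by (simp_all add: l2 vec_eq_iff all_index)
  then show ?thesis using nonzero by (simp add: prod_eq_iff)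
qed

text \<open>Along the second factor all derivatives of the pullback vanish, and what remains of the
  equation is \<open>(l2 sigma + tau) g2\<close>. The condition \<open>tau\<close> makes its
  coefficient \<open>(l1 + l2) sigma\<close>, which is zero.\<close>

lemma parallel_pullback:
  assumes T: "parallel_tractor M1 g1 T"
    and tau: "\<And>c p. c \<in> charts M1 \<Longrightarrow> p \<in> cdom M1 c \<Longrightarrow> tr_tau T c p = l1 * tr_sigma T c p"
  shows "parallel_tractor M g (\<lambda>z x. pullback_map u (T (cp1 z) (pr1 x)))"
    (is "parallel_tractor M g ?S")
proof -
  have sec: "tractor_section M1 T" using T by (simp add: parallel_tractor_def)
  have smooth: "smooth_in_chart M1 c (T c)" if "c \<in> charts M1" for c
    using sec that by (simp add: tractor_section_def)
  have S: "tractor_section M ?S"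
    unfolding tractor_section_def
  proof (intro conjI ballI)
    show "smooth_in_chart M z (?S z)" if "z \<in> charts M" for z
      by (rule smooth_pullback[OF that smooth[OF cp1_charts[OF that]] bounded_linear_pullback_map refl])
  next
    fix z w x assume c: "z \<in> charts M" "w \<in> charts M" "x \<in> cdom M z \<inter> cdom M w"
    then have "cp1 z \<in> charts M1" "cp1 w \<in> charts M1" "pr1 x \<in> cdom M1 (cp1 z) \<inter> cdom M1 (cp1 w)"
      by (auto simp: charts_iff cdom_iff)
    then have eq: "tr_sigma T (cp1 z) (pr1 x) = tr_sigma T (cp1 w) (pr1 x)"
      "tr_tau T (cp1 z) (pr1 x) = tr_tau T (cp1 w) (pr1 x)"
      "tr_mu T (cp1 z) (pr1 x) =
        transpose (jacobian_mat M1 (cp1 z) (cp1 w) (pr1 x)) *v tr_mu T (cp1 w) (pr1 x)"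
      using sec unfolding tractor_section_def by blast+
    show "tr_sigma ?S z x = tr_sigma ?S w x" "tr_tau ?S z x = tr_tau ?S w x"
      by (simp_all add: pullback_map_def eq(1,2))
    show "tr_mu ?S z x = transpose (jacobian_mat M z w x) *v tr_mu ?S w x"
      unfolding vec_eq_iff all_index
      by (simp add: pullback_map_def eq(3) matrix_vector_mult_def transpose_def sum_split
          jacobian_product[OF c])
  qed
  have "tractor_deriv M g ?S z k x = 0" if z: "z \<in> charts M" and x: "x \<in> cdom M z" for z k x
  proof -
    let ?c = "cp1 z" and ?p = "pr1 x"
    have c: "?c \<in> charts M1" "?p \<in> cdom M1 ?c" using z x by (auto simp: charts_iff cdom_iff)
    have "diff_in_chart M1 ?c (T ?c) ?p"
      by (rule smooth_in_chart_diff[OF man1 c(1) smooth[OF c(1)] c(2)])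
    note diffs = diff_tractor_components[of M1 ?c T, OF this]
    have pb: "pd M z (u i) (tr_sigma ?S z) x = pd M1 ?c i (tr_sigma T ?c) ?p"
      "pd M z (v j) (tr_sigma ?S z) x = 0"
      "pd M z (u i) (tr_tau ?S z) x = pd M1 ?c i (tr_tau T ?c) ?p"
      "pd M z (v j) (tr_tau ?S z) x = 0"
      "pd M z (u i) (\<lambda>y. tr_mu ?S z y $ u b) x = pd M1 ?c i (\<lambda>y. tr_mu T ?c y $ b) ?p"
      "pd M z (v j) (\<lambda>y. tr_mu ?S z y $ u b) x = 0"
      "pd M z m (\<lambda>y. tr_mu ?S z y $ v b') x = 0" for i j m b b'
      by (simp_all add: pullback_map_def pd_pullback[OF z x diffs(1)] pd_pullback[OF z x diffs(2)]
          pd_pullback[OF z x diffs(3)] pd_product_zero[OF z x])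
    have eqs: "pd M1 ?c a (tr_sigma T ?c) ?p = tr_mu T ?c ?p $ a"
      "pd M1 ?c a (\<lambda>y. tr_mu T ?c y $ b) ?p
        - (\<Sum>k\<in>UNIV. christoffel M1 g1 ?c k a b ?p * tr_mu T ?c ?p $ k)
        + (l1 * tr_sigma T ?c ?p + tr_tau T ?c ?p) * g1 ?c ?p $ a $ b = 0"
      "pd M1 ?c a (tr_tau T ?c) ?p = l1 * tr_mu T ?c ?p $ a" for a b
      using T c F1.tractor_deriv_zero_iff[OF c, of T a]
      by (auto simp: parallel_tractor_def covector_deriv_def)
    have "l2 * tr_sigma T ?c ?p + tr_tau T ?c ?p = (l1 + l2) * tr_sigma T ?c ?p"
      using tau[OF c] by (simp add: algebra_simps)
    then have l2: "l2 * tr_sigma T ?c ?p + tr_tau T ?c ?p = 0" by (simp add: opposite)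
    show ?thesis
    proof (cases k rule: index_cases)
      case (1 a)
      show ?thesis unfolding 1 tractor_deriv_u[OF z x] pb
        using eqs[of a] by (simp add: pullback_map_def)
    next
      case (2 a)
      show ?thesis unfolding 2 tractor_deriv_v[OF z x] pb
        using l2 by (simp add: pullback_map_def)
    qed
  qed
  with S show ?thesis by (simp add: parallel_tractor_def)
qed

lemma almost_einstein_of_two_independent:
  assumes "two_independent_almost_einstein M1 g1"
  shows "conformally_almost_einstein M g"
proof -
  obtain T c p where T: "parallel_tractor M1 g1 T" "c \<in> charts M1" "p \<in> cdom M1 c" "T c p \<noteq> 0"
    and tau: "\<And>c p. c \<in> charts M1 \<Longrightarrow> p \<in> cdom M1 c \<Longrightarrow> tr_tau T c p = l1 * tr_sigma T c p"
    using F1.two_independent_imp_parallel[OF assms] by blast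
  \<comment> \<open>A point of \<open>M2\<close> is needed to have a point of the product over
    \<open>p\<close>, where the pullback is nonzero.\<close>
  have "topspace (mtop M2) \<noteq> {}" "(\<Union>d\<in>charts M2. cdom M2 d) = topspace (mtop M2)"
    using man2 unfolding smooth_manifold_def by blast+
  then obtain d q where d: "d \<in> charts M2" "q \<in> cdom M2 d" by blast
  let ?S = "\<lambda>z x. pullback_map u (T (cp1 z) (pr1 x))"
  have "parallel_tractor M g ?S" by (rule parallel_pullback[OF T(1) tau])
  moreover have "mkc c d \<in> charts M" "mk p q \<in> cdom M (mkc c d)"
    using T d by (simp_all add: charts_iff cdom_iff cp_mkc pr_mk)
  moreover have "?S (mkc c d) (mk p q) \<noteq> 0"
    using T(4) by (auto simp: pullback_map_def cp_mkc pr_mk zero_prod_def prod_eq_iff vec_eq_iff all_index)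
  ultimately show ?thesis
    by (auto simp: conformally_almost_einstein_def almost_einstein_structure_def)
qed

lemma almost_einstein_iff_two_independent:
  "conformally_almost_einstein M g \<longleftrightarrow>
     two_independent_almost_einstein M1 g1 \<or> two_independent_almost_einstein M2 g2"
proof
  assume "conformally_almost_einstein M g"
  then obtain T z x where T: "parallel_tractor M g T" "z \<in> charts M" "x \<in> cdom M z" "T z x \<noteq> 0"
    by (auto simp: conformally_almost_einstein_def almost_einstein_structure_def)
  then have "slice_map u l1 (T z x) \<noteq> 0 \<or> slice_map v l2 (T z x) \<noteq> 0"
    using slice_maps_zero by blast
  then show "two_independent_almost_einstein M1 g1 \<or> two_independent_almost_einstein M2 g2"
    using two_independent_of_slice[OF T(1-3)]
      product_einstein.two_independent_of_slice[OF swap_einstein T(1-3)] by blast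
next
  assume "two_independent_almost_einstein M1 g1 \<or> two_independent_almost_einstein M2 g2"
  then show "conformally_almost_einstein M g"
    using almost_einstein_of_two_independent
      product_einstein.almost_einstein_of_two_independent[OF swap_einstein] by blast
qed

end

lemma product_einstein_product:
  fixes M1 :: "('p1, 'c1, 'n1::finite) atlas" and M2 :: "('p2, 'c2, 'n2::finite) atlas"
  assumes "einstein_constant M1 g1 l" "einstein_constant M2 g2 (- l)" "l \<noteq> 0"
  shows "product_einstein Inl Inr (product_manifold M1 M2) M1 M2 fst snd Pair fst snd Pair
    g1 l g2 (- l) (product_metric g1 g2)"
proof -
  have "index_split (Inl :: 'n1 \<Rightarrow> 'n1 + 'n2) Inr"
    by unfold_locales (auto simp: UNIV_sum)
  then have "product_atlas Inl Inr (product_manifold M1 M2) M1 M2 fst snd Pair fst snd Pair"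
    using einstein_constant.manifold[OF assms(1)] einstein_constant.manifold[OF assms(2)]
    by (intro product_atlas.intro product_atlas_axioms.intro)
      (auto simp: product_manifold_def split_beta)
  then show ?thesis
    using assms
    by (intro product_einstein.intro product_einstein_axioms.intro)
      (auto simp: product_metric_def split_beta)
qed

theorem theorem3p4:
  fixes M1 :: "('p1, 'c1, 'n1::finite) atlas" and g1 :: "('p1, 'c1, 'n1) metric" and Sc1 :: real
    and M2 :: "('p2, 'c2, 'n2::finite) atlas" and g2 :: "('p2, 'c2, 'n2) metric" and Sc2 :: real
    and m1 m2 :: nat
  assumes "m1 = CARD('n1)" and "m2 = CARD('n2)"
    and "einstein_manifold M1 g1 Sc1" and "einstein_manifold M2 g2 Sc2"
    and "real m2 * (real m2 - 1) * Sc1 = - (real m1 * (real m1 - 1) * Sc2)"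
    and "real m2 * (real m2 - 1) * Sc1 \<noteq> 0"
  shows "conformally_almost_einstein (product_manifold M1 M2) (product_metric g1 g2) \<longleftrightarrow>
         two_independent_almost_einstein M1 g1 \<or> two_independent_almost_einstein M2 g2"
proof -
  have "real m1 * (real m1 - 1) * Sc2 \<noteq> 0" using assms(5,6) by linarith
  with assms(6) have nz: "real m1 \<noteq> 0" "real m1 - 1 \<noteq> 0" "real m2 \<noteq> 0" "real m2 - 1 \<noteq> 0" "Sc1 \<noteq> 0"
    by simp_all
  \<comment> \<open>Nonvanishing of both sides of the curvature condition excludes the dimensions 0
    and 1.\<close>
  then have m: "m1 \<ge> 2" "m2 \<ge> 2" by auto
  \<comment> \<open>The value for which the Schouten tensor of \<open>g1\<close> is
    \<open>l g1\<close>; in these terms the curvature condition says that the value for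
    \<open>g2\<close> is \<open>- l\<close>.\<close>
  define l where "l = Sc1 / (2 * real m1 * (real m1 - 1))"
  have "l \<noteq> 0" using nz by (simp add: l_def)
  have "Sc1 = 2 * l * real m1 * (real m1 - 1)"
    using nz by (simp add: l_def)
  moreover have "Sc2 = 2 * (- l) * real m2 * (real m2 - 1)"
  proof -
    have "real m1 * (real m1 - 1) * Sc2 = real m1 * (real m1 - 1) * (2 * (- l) * real m2 * (real m2 - 1))"
      using assms(5) unfolding \<open>Sc1 = 2 * l * real m1 * (real m1 - 1)\<close> by algebra
    moreover have "real m1 * (real m1 - 1) \<noteq> 0" using nz by simp
    ultimately show ?thesis using mult_left_cancel by blast
  qed
  ultimately have "einstein_constant M1 g1 l" "einstein_constant M2 g2 (- l)"
    using assms(1-4) m by (simp_all add: einstein_constant_def)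
  from product_einstein.almost_einstein_iff_two_independent[OF
      product_einstein_product[OF this \<open>l \<noteq> 0\<close>]]
  show ?thesis .
qed

end
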